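(* Let $\mathcal U$ be the uniform distribution on the Clifford group $\mathrm{Cl}_n$ and $O=|\phi\rangle\langle\phi|-\mathbb 1/d$ with $|\phi\rangle\in\mathcal H$ a pure state. Then $$V_*(O)<\frac{2^{1-M_2(\phi)/2}(d+1)}{d+2},\qquad V_*(O,\phi)=\frac{2^{1-M_2(\phi)}(d+1)-4}{d+2}<2^{1-M_2(\phi)}.$$
   Context: Let $n\ge1$, $d=2^n$, $\mathcal H=(\mathbb C^2)^{\otimes n}$ with computational basis $\{|\mathbf b\rangle\}$. For a unitary ensemble $\mathcal U$ with measurement channel $\mathcal M(X)=\mathbb E_{U}\sum_{\mathbf b}\langle\mathbf b|UXU^\dagger|\mathbf b\rangle U^\dagger|\mathbf b\rangle\langle\mathbf b|U$ (for a 2-design, $\mathcal M^{-1}(O)=(d+1)O-\operatorname{tr}(O)\mathbb 1$), define for a density operator $\rho$ and traceless Hermitian $O$: $V_*(O,\rho)=\mathbb E_{U}\bigl(\sum_{\mathbf b}\langle\mathbf b|U\rho U^\dagger|\mathbf b\rangle\langle\mathbf b|U\mathcal M^{-1}(O)U^\dagger|\mathbf b\rangle\bigr)^2-[\operatorname{tr}(O\rho)]^2$, $V_*(O)=\max_\rho V_*(O,\rho)$, and $V_*(O,\phi)=V_*(O,|\phi\rangle\langle\phi|)$. $\mathrm{Cl}_n$ is the $n$-qubit Clifford group. With $\overline{\mathcal P}_n=\{I,X,Y,Z\}^{\otimes n}$ and $\Xi_\phi(P)=\langle\phi|P|\phi\rangle$, the stabilizer 2-Rényi entropy of $|\phi\rangle$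 is $M_2(\phi)=-\log_2\bigl(\frac1d\sum_{P\in\overline{\mathcal P}_n}\Xi_\phi(P)^4\bigr)$. *)

theory Defs
  imports Complex_Main
begin

text \<open>n-qubit operators on (C^2)^{\<otimes>n} are represented as d x d complex matrices,
  d = 2^n, given as functions nat => nat => complex that vanish outside {..<d}.
  The computational basis vector |b> is the b-th standard basis vector, and the
  k-th qubit of the basis index i is bit k of i.\<close>

type_synonym cmat = "nat \<Rightarrow> nat \<Rightarrow> complex"
type_synonym cvec = "nat \<Rightarrow> complex"

definition bitq :: "nat \<Rightarrow> nat \<Rightarrow> nat" where
  "bitq k i = (i div 2 ^ k) mod 2"

definition flipq :: "nat \<Rightarrow> nat \<Rightarrow> nat" where
  "flipq k i = (if bitq k i = 0 then i + 2 ^ k else i - 2 ^ k)"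

definition supp_mat :: "nat \<Rightarrow> cmat \<Rightarrow> bool" where
  "supp_mat d A \<longleftrightarrow> (\<forall>i j. (d \<le> i \<or> d \<le> j) \<longrightarrow> A i j = 0)"

definition mmul :: "nat \<Rightarrow> cmat \<Rightarrow> cmat \<Rightarrow> cmat" where
  "mmul d A B = (\<lambda>i j. if i < d \<and> j < d then (\<Sum>k<d. A i k * B k j) else 0)"

definition madd :: "nat \<Rightarrow> cmat \<Rightarrow> cmat \<Rightarrow> cmat" where
  "madd d A B = (\<lambda>i j. if i < d \<and> j < d then A i j + B i j else 0)"

definition msmult :: "nat \<Rightarrow> complex \<Rightarrow> cmat \<Rightarrow> cmat" where
  "msmult d c A = (\<lambda>i j. if i < d \<and> j < d then c * A i j else 0)"

definition dag :: "nat \<Rightarrow> cmat \<Rightarrow> cmat" where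
  "dag d A = (\<lambda>i j. if i < d \<and> j < d then cnj (A j i) else 0)"

definition idm :: "nat \<Rightarrow> cmat" where
  "idm d = (\<lambda>i j. if i < d \<and> j = i then 1 else 0)"

definition tr :: "nat \<Rightarrow> cmat \<Rightarrow> complex" where
  "tr d A = (\<Sum>i<d. A i i)"

definition gate1 :: "nat \<Rightarrow> nat \<Rightarrow> cmat \<Rightarrow> cmat" where
  "gate1 n j g = (\<lambda>i i'. if i < 2 ^ n \<and> i' < 2 ^ n \<and> (\<forall>k<n. k \<noteq> j \<longrightarrow> bitq k i = bitq k i')
                         then g (bitq j i) (bitq j i') else 0)"

definition hadamard :: cmat where
  "hadamard a b = (if a = 1 \<and> b = 1 then - 1 else 1) / complex_of_real (sqrt 2)"

definition sgate :: cmat where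
  "sgate a b = (if a = b then (if a = 0 then 1 else \<i>) else 0)"

definition cnot :: "nat \<Rightarrow> nat \<Rightarrow> nat \<Rightarrow> cmat" where
  "cnot n c t = (\<lambda>i i'. if i < 2 ^ n \<and> i' < 2 ^ n \<and>
                    i = (if bitq c i' = 1 then flipq t i' else i') then 1 else 0)"

inductive_set clifford :: "nat \<Rightarrow> cmat set" for n :: nat where
  cl_id: "idm (2 ^ n) \<in> clifford n"
| cl_H: "U \<in> clifford n \<Longrightarrow> j < n \<Longrightarrow> mmul (2 ^ n) (gate1 n j hadamard) U \<in> clifford n"
| cl_S: "U \<in> clifford n \<Longrightarrow> j < n \<Longrightarrow> mmul (2 ^ n) (gate1 n j sgate) U \<in> clifford n"
| cl_CNOT: "U \<in> clifford n \<Longrightarrow> c < n \<Longrightarrow> t < n \<Longrightarrow> c \<noteq> t \<Longrightarrow>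
            mmul (2 ^ n) (cnot n c t) U \<in> clifford n"

definition cl_avg :: "nat \<Rightarrow> (cmat \<Rightarrow> real) \<Rightarrow> real" where
  "cl_avg n f = (\<Sum>U\<in>clifford n. f U) / real (card (clifford n))"

definition conj_diag :: "nat \<Rightarrow> cmat \<Rightarrow> cmat \<Rightarrow> nat \<Rightarrow> complex" where
  "conj_diag d U X b = mmul d (mmul d U X) (dag d U) b b"

text \<open>Measurement channel M(X) = E_U sum_b <b|UXU^dagger|b> U^dagger|b><b|U.\<close>
definition meas_channel :: "nat \<Rightarrow> cmat \<Rightarrow> cmat" where
  "meas_channel n X = (\<lambda>i j. if i < 2 ^ n \<and> j < 2 ^ n then
      (\<Sum>U\<in>clifford n. \<Sum>b<2 ^ n. conj_diag (2 ^ n) U X b * (cnj (U b i) * U b j))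
        / of_nat (card (clifford n)) else 0)"

definition meas_inv :: "nat \<Rightarrow> cmat \<Rightarrow> cmat" where
  "meas_inv n Ob = (THE X. supp_mat (2 ^ n) X \<and> meas_channel n X = Ob)"

definition density :: "nat \<Rightarrow> cmat \<Rightarrow> bool" where
  "density n \<rho> \<longleftrightarrow> supp_mat (2 ^ n) \<rho> \<and>
     (\<forall>i j. \<rho> i j = cnj (\<rho> j i)) \<and>
     (\<forall>v :: cvec. 0 \<le> Re (\<Sum>i<2 ^ n. \<Sum>j<2 ^ n. cnj (v i) * \<rho> i j * v j)) \<and>
     tr (2 ^ n) \<rho> = 1"

definition Vshadow :: "nat \<Rightarrow> cmat \<Rightarrow> cmat \<Rightarrow> real" where
  "Vshadow n Ob \<rho> =
     cl_avg n (\<lambda>U. (Re (\<Sum>b<2 ^ n. conj_diag (2 ^ n) U \<rho> b * conj_diag (2 ^ n) U (meas_inv n Ob) b)) ^ 2)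
     - (Re (tr (2 ^ n) (mmul (2 ^ n) Ob \<rho>))) ^ 2"

definition Vshadow_max :: "nat \<Rightarrow> cmat \<Rightarrow> real" where
  "Vshadow_max n Ob = Sup {Vshadow n Ob \<rho> | \<rho>. density n \<rho>}"

definition unit_state :: "nat \<Rightarrow> cvec \<Rightarrow> bool" where
  "unit_state n \<phi> \<longleftrightarrow> (\<Sum>i<2 ^ n. (cmod (\<phi> i))\<^sup>2) = 1"

definition proj :: "nat \<Rightarrow> cvec \<Rightarrow> cmat" where
  "proj n \<phi> = (\<lambda>i j. if i < 2 ^ n \<and> j < 2 ^ n then \<phi> i * cnj (\<phi> j) else 0)"

definition pauli1 :: "nat \<Rightarrow> cmat" where
  "pauli1 p a b =
     (if p = 0 then (if a = b then 1 else 0)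
      else if p = 1 then (if a \<noteq> b then 1 else 0)
      else if p = 2 then (if a = 0 \<and> b = 1 then - \<i> else if a = 1 \<and> b = 0 then \<i> else 0)
      else (if a = b then (if a = 0 then 1 else - 1) else 0))"

definition pauli_strings :: "nat \<Rightarrow> nat list set" where
  "pauli_strings n = {ps. length ps = n \<and> set ps \<subseteq> {..<4}}"

definition pauli :: "nat \<Rightarrow> nat list \<Rightarrow> cmat" where
  "pauli n ps = (\<lambda>i j. if i < 2 ^ n \<and> j < 2 ^ n then
      (\<Prod>k<n. pauli1 (ps ! k) (bitq k i) (bitq k j)) else 0)"

definition Xi :: "nat \<Rightarrow> cvec \<Rightarrow> nat list \<Rightarrow> real" where
  "Xi n \<phi> ps = Re (\<Sum>i<2 ^ n. \<Sum>j<2 ^ n. cnj (\<phi> i) * pauli n ps i j * \<phi> j)"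

definition M2 :: "nat \<Rightarrow> cvec \<Rightarrow> real" where
  "M2 n \<phi> = - log 2 ((1 / 2 ^ n) * (\<Sum>ps\<in>pauli_strings n. (Xi n \<phi> ps) ^ 4))"

end

(* A Pauli operator is determined up to phase by a vector v in F_2^n x F_2^n, and conjugation by a
   Clifford unitary acts on these vectors by a symplectic map. A shot is a quadratic expression in which
   every Pauli operator occurs twice, so phases cancel: the shot value is 1/d times the sum of
   f(v) = tr(P_v rho) tr(P_v O) over the v that U maps to diagonal operators. Its second moment is
   determined by the number of U that diagonalise a given pair v, w; this number depends only on whether
   v = w and whether v and w commute, because symplectic transvections act transitively on such pairs.
   With the matrix S of signs S(v,w) = +1 (commuting), -1 (anticommuting) this gives
     V(O, rho) = (d+1) / (d (d+2)) * (sum f^2 + (f, S f) / d) - tr(O rho)^2 / (d+2).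
   Since S^2 = d^2, (f, S f) <= d sum f^2, and the Cauchy-Schwarz inequality bounds sum f^2 by fourth
   moments of Pauli expectations. For rho = |phi><phi| the vector of squared Pauli expectations is an
   eigenvector of S, which gives the exact value. *)
theory Submission
  imports Defs "Jordan_Normal_Form.Determinant" "HOL-Analysis.Convex"
begin

unbundle bit_operations_syntax

section \<open>Bits and characters\<close>

text \<open>The square of a shot contains four copies of \<open>U\<close> and four of its adjoint,
  and the Clifford group is not a unitary 4-design, so a Haar integral does not supply the average;
  counting jointly diagonalised pairs takes its place. The counting averages over
  \<open>clifford n\<close>, which is generated as a set of matrices with their phases, so its
  finiteness has to be proved: for an infinite set both \<open>card\<close> and the sums would be 0.
  Since \<open>meas_inv\<close> is a definite description, the channel is computed on every matrix
  and the preimage of \<open>Ob\<close> is shown to be unique; this uses the same counting. A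
  supremum over rho preserves only weak inequalities. Strictness comes from the trace of the
  observable being 0: the identity component drops out of f, and Cauchy-Schwarz on the rest gives
  sqrt((d - 1) (s - 1)), uniformly in rho, where s = d 2^(-M2) is the sum of the fourth powers of
  the Pauli expectations of phi. This lies strictly below sqrt(d s) = d 2^(-M2/2).\<close>

lemma bitq_eq: "bitq k i = of_bool (bit i k)"
  by (simp add: bitq_def bit_iff_odd mod_2_eq_odd)

lemma flipq_eq: "flipq k i = i XOR 2 ^ k"
proof -
  have "i = unset_bit k i + 2 ^ k" if "bit i k"
  proof -
    have "i = set_bit k (unset_bit k i)"
      using that by (intro bit_eqI) (auto simp: bit_set_bit_iff bit_unset_bit_iff)
    then show ?thesis by (simp add: set_bit_eq bit_unset_bit_iff)
  qed
  then have "flipq k i = flip_bit k i"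
    by (auto simp: flipq_def bitq_eq flip_bit_eq_if set_bit_eq)
  then show ?thesis by (simp add: flip_bit_eq_xor)
qed

lemma less_exp_iff_bits: "(a::nat) < 2 ^ n \<longleftrightarrow> (\<forall>k. bit a k \<longrightarrow> k < n)"
proof -
  have "a < 2 ^ n \<longleftrightarrow> take_bit n a = a"
    by (simp add: take_bit_nat_eq_self_iff)
  also have "\<dots> \<longleftrightarrow> (\<forall>k. bit a k \<longrightarrow> k < n)"
    by (auto simp: bit_eq_iff bit_take_bit_iff)
  finally show ?thesis .
qed

lemma xor_less_exp [simp]: "(a::nat) < 2 ^ n \<Longrightarrow> b < 2 ^ n \<Longrightarrow> a XOR b < 2 ^ n"
  by (auto simp: less_exp_iff_bits bit_xor_iff)

lemma xor_xor_cancel [simp]: "((a::nat) XOR b) XOR b = a" "(b::nat) XOR (b XOR a) = a"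
  "(a::nat) XOR (b XOR a) = b" "((b::nat) XOR a) XOR b = a"
  by (auto simp: bit_eq_iff bit_xor_iff)

lemma xor_eq_iff: "(a::nat) XOR b = c \<longleftrightarrow> a = c XOR b"
  by auto

lemma bit_exp_nat [simp]: "bit ((2::nat) ^ k) m \<longleftrightarrow> m = k"
  by (auto simp: bit_exp_iff)

lemma eq_if_bits_below: "(a::nat) < 2 ^ n \<Longrightarrow> b < 2 ^ n \<Longrightarrow> (\<And>k. k < n \<Longrightarrow> bit a k = bit b k) \<Longrightarrow> a = b"
  unfolding less_exp_iff_bits bit_eq_iff by blast

lemma bij_betw_xor: "(c::nat) < 2 ^ n \<Longrightarrow> bij_betw (\<lambda>a. a XOR c) {..<2 ^ n} {..<2 ^ n}"
  by (rule bij_betwI[where g="\<lambda>a. a XOR c"]) auto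

lemma sum_xor_reindex: "(c::nat) < 2 ^ n \<Longrightarrow> (\<Sum>a<2 ^ n. f (a XOR c)) = (\<Sum>a<2 ^ n. f a)"
  by (rule sum.reindex_bij_betw[OF bij_betw_xor])

lemma sum_xor_reindex': "(c::nat) < 2 ^ n \<Longrightarrow> (\<Sum>a<2 ^ n. f (c XOR a)) = (\<Sum>a<2 ^ n. f a)"
  using sum_xor_reindex[of c n f] by (simp add: xor.commute)

text \<open>The character (-1)^(a . b) of the group F_2^n, whose addition is XOR. It is kept real so
  that the signs can enter inequalities.\<close>

definition chi :: "nat \<Rightarrow> nat \<Rightarrow> nat \<Rightarrow> real" where
  "chi n a b = (\<Prod>k<n. if bit a k \<and> bit b k then - 1 else 1)"

lemma chi_commute: "chi n a b = chi n b a"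
  by (simp add: chi_def conj_commute)

lemma chi_xor_left: "chi n (a XOR a') b = chi n a b * chi n a' b"
  unfolding chi_def prod.distrib[symmetric] by (rule prod.cong) (auto simp: bit_xor_iff)

lemma chi_xor_right: "chi n b (a XOR a') = chi n b a * chi n b a'"
  by (metis chi_commute chi_xor_left)

lemma chi_0 [simp]: "chi n 0 b = 1" "chi n b 0 = 1"
  by (simp_all add: chi_def)

lemma chi_exp_right: "k < n \<Longrightarrow> chi n a (2 ^ k) = (if bit a k then - 1 else 1)"
proof -
  assume "k < n"
  have "chi n a (2 ^ k) = (\<Prod>m<n. if m = k then (if bit a k then - 1 else 1) else 1)"
    unfolding chi_def by (rule prod.cong) auto
  then show ?thesis using \<open>k < n\<close> by simp
qed

lemma chi_exp_left: "k < n \<Longrightarrow> chi n (2 ^ k) a = (if bit a k then - 1 else 1)"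
  by (metis chi_commute chi_exp_right)

lemma chi_sq [simp]: "chi n a b * chi n a b = 1"
  unfolding chi_def prod.distrib[symmetric] by (rule prod.neutral) auto

lemma chi_sq_left [simp]: "chi n a b * (chi n a b * c) = c"
  by (simp add: mult.assoc[symmetric])

lemma chi_cases: "chi n a b = 1 \<or> chi n a b = - 1"
  using chi_sq[of n a b] by (simp only: square_eq_1_iff)

text \<open>If bit \<open>k\<close> of \<open>a\<close> is set, translating the summation variable
  by \<open>2 ^ k\<close> negates every term, so the sum equals its own negative.\<close>

lemma sum_chi: 
  assumes "a < 2 ^ n"
  shows "(\<Sum>b<2 ^ n. chi n a b) = (if a = 0 then 2 ^ n else 0)"
proof (cases "a = 0")
  case False
  then obtain k where k: "bit a k" by (metis bit_0_eq bit_eq_iff bot_apply bot_bool_def)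
  with assms have kn: "k < n" by (auto simp: less_exp_iff_bits)
  have "(\<Sum>b<2 ^ n. chi n a b) = (\<Sum>b<2 ^ n. chi n a (b XOR 2 ^ k))"
    using kn by (intro sum_xor_reindex[symmetric]) simp
  also have "\<dots> = - (\<Sum>b<2 ^ n. chi n a b)"
    using k kn by (simp add: chi_xor_right chi_exp_right sum_negf)
  finally show ?thesis using False by simp
qed simp

lemma sum_chi_chi:
  assumes "a < 2 ^ n" "a' < 2 ^ n"
  shows "(\<Sum>b<2 ^ n. chi n a b * chi n a' b) = (if a = a' then 2 ^ n else 0)"
proof -
  have "a XOR a' = 0 \<longleftrightarrow> a = a'" by (auto simp: xor_eq_iff)
  then show ?thesis
    using sum_chi[of "a XOR a'" n] assms by (simp add: chi_xor_left)
qed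

lemma sum_chi_chi':
  assumes "a < 2 ^ n" "a' < 2 ^ n"
  shows "(\<Sum>b<2 ^ n. chi n b a * chi n b a') = (if a = a' then 2 ^ n else 0)"
  using sum_chi_chi[OF assms] by (simp add: chi_commute)

section \<open>The symplectic space of Pauli vectors\<close>

type_synonym pvec = "nat \<times> nat"

definition pvecs :: "nat \<Rightarrow> pvec set" where
  "pvecs n = {..<2 ^ n} \<times> {..<2 ^ n}"

definition padd :: "pvec \<Rightarrow> pvec \<Rightarrow> pvec" where
  "padd v w = (fst v XOR fst w, snd v XOR snd w)"

definition symp_sign :: "nat \<Rightarrow> pvec \<Rightarrow> pvec \<Rightarrow> real" where
  "symp_sign n v w = chi n (fst v) (snd w) * chi n (snd v) (fst w)"

abbreviation pzero :: pvec where "pzero \<equiv> (0, 0)"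

lemma finite_pvecs [simp]: "finite (pvecs n)" and card_pvecs: "card (pvecs n) = 2 ^ n * 2 ^ n"
  by (simp_all add: pvecs_def)

lemma pzero_in_pvecs [simp]: "pzero \<in> pvecs n"
  by (simp add: pvecs_def)

lemma padd_in_pvecs [simp]: "v \<in> pvecs n \<Longrightarrow> w \<in> pvecs n \<Longrightarrow> padd v w \<in> pvecs n"
  by (auto simp: pvecs_def padd_def)

lemma padd_cancel [simp]: "padd v (padd v w) = w" "padd (padd w v) v = w" "padd v pzero = v" "padd pzero v = v"
  by (simp_all add: padd_def)

lemma padd_eq_pzero_iff [simp]: "padd v w = pzero \<longleftrightarrow> v = w"
  by (auto simp: padd_def xor_eq_iff prod_eq_iff)

lemma symp_sign_commute: "symp_sign n v w = symp_sign n w v"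
  by (simp add: symp_sign_def chi_commute mult.commute)

lemma symp_sign_padd_left: "symp_sign n (padd u v) w = symp_sign n u w * symp_sign n v w"
  by (simp add: symp_sign_def padd_def chi_xor_left mult_ac)

lemma symp_sign_pzero [simp]: "symp_sign n pzero w = 1" "symp_sign n w pzero = 1"
  by (simp_all add: symp_sign_def)

lemma symp_sign_self [simp]: "symp_sign n v v = 1"
  by (simp add: symp_sign_def chi_commute)

lemma symp_sign_sq [simp]: "symp_sign n v w * symp_sign n v w = 1"
  by (simp add: symp_sign_def mult.assoc mult.left_commute)

lemma symp_sign_cases: "symp_sign n v w = 1 \<or> symp_sign n v w = - 1"
  using symp_sign_sq[of n v w] by (simp only: square_eq_1_iff)

text \<open>Nondegeneracy of the symplectic form, in terms of characters. The sum factors into one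
  character sum for each half of the vector.\<close>

lemma sum_symp_sign:
  assumes "v \<in> pvecs n"
  shows "(\<Sum>w\<in>pvecs n. symp_sign n v w) = (if v = pzero then 2 ^ n * 2 ^ n else 0)"
proof -
  have "(\<Sum>w\<in>pvecs n. symp_sign n v w) = (\<Sum>a<2 ^ n. \<Sum>b<2 ^ n. chi n (fst v) b * chi n (snd v) a)"
    unfolding pvecs_def symp_sign_def by (simp add: sum.cartesian_product case_prod_beta)
  also have "\<dots> = (\<Sum>b<2 ^ n. chi n (fst v) b) * (\<Sum>a<2 ^ n. chi n (snd v) a)"
    by (simp add: sum_distrib_left sum_distrib_right mult.commute)
  also have "\<dots> = (if v = pzero then 2 ^ n * 2 ^ n else 0)"
    using assms by (cases v) (auto simp: pvecs_def sum_chi)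
  finally show ?thesis .
qed

lemma sum_symp_sign_symp_sign:
  assumes "v \<in> pvecs n" "w \<in> pvecs n"
  shows "(\<Sum>u\<in>pvecs n. symp_sign n v u * symp_sign n w u) = (if v = w then 2 ^ n * 2 ^ n else 0)"
  using sum_symp_sign[of "padd v w" n] assms by (simp add: symp_sign_padd_left)

text \<open>The product of the factors 1 - S(., r) is four times the indicator of the wanted
  \<open>r\<close>. Expanded, it is a sum of characters of \<open>r\<close>: the nontrivial ones add
  up to 0, and the trivial ones carry a positive sign, so the count is positive.\<close>

lemma exists_anticommuting_pair:
  assumes "v \<in> pvecs n" "w \<in> pvecs n" "v \<noteq> pzero" "w \<noteq> pzero"
  obtains r where "r \<in> pvecs n" "symp_sign n v r = - 1" "symp_sign n w r = - 1"
proof -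
  have "\<exists>r\<in>pvecs n. symp_sign n v r = - 1 \<and> symp_sign n w r = - 1"
  proof (rule ccontr)
    assume "\<not> ?thesis"
    then have "0 = (\<Sum>r\<in>pvecs n. (1 - symp_sign n v r) * (1 - symp_sign n w r))"
      by (intro sum.neutral[symmetric] ballI) (use symp_sign_cases in fastforce)
    also have "\<dots> = (\<Sum>r\<in>pvecs n. 1 - symp_sign n v r - symp_sign n w r + symp_sign n (padd v w) r)"
      by (rule sum.cong) (auto simp: symp_sign_padd_left algebra_simps)
    also have "\<dots> = 2 ^ n * 2 ^ n + (if v = w then 2 ^ n * 2 ^ n else 0)"
      using assms by (simp add: sum.distrib sum_subtractf sum_symp_sign card_pvecs)
    finally show False by (simp split: if_splits)
  qed
  then show ?thesis using that by blast
qed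

text \<open>The same character count with a third factor for commuting with \<open>p\<close>. The
  hypotheses exclude every trivial character with a negative sign; the only other one that can be
  trivial is that of p + v + w, and it enters with a positive sign.\<close>

lemma exists_anticommuting_pair_commuting:
  assumes "p \<in> pvecs n" "v \<in> pvecs n" "w \<in> pvecs n" "v \<noteq> pzero" "w \<noteq> pzero" "p \<noteq> pzero"
    and "p \<noteq> v" "p \<noteq> w" "v \<noteq> w"
  obtains r where "r \<in> pvecs n" "symp_sign n v r = - 1" "symp_sign n w r = - 1" "symp_sign n p r = 1"
proof -
  have "\<exists>r\<in>pvecs n. symp_sign n v r = - 1 \<and> symp_sign n w r = - 1 \<and> symp_sign n p r = 1"
  proof (rule ccontr)
    assume "\<not> ?thesis"
    then have "0 = (\<Sum>r\<in>pvecs n. (1 + symp_sign n p r) * (1 - symp_sign n v r) * (1 - symp_sign n w r))"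
      by (intro sum.neutral[symmetric] ballI) (use symp_sign_cases in fastforce)
    also have "\<dots> = (\<Sum>r\<in>pvecs n. 1 - symp_sign n v r - symp_sign n w r + symp_sign n (padd v w) r
         + symp_sign n p r - symp_sign n (padd p v) r - symp_sign n (padd p w) r + symp_sign n (padd p (padd v w)) r)"
      by (rule sum.cong) (auto simp: symp_sign_padd_left algebra_simps)
    also have "\<dots> = 2 ^ n * 2 ^ n + (if p = padd v w then 2 ^ n * 2 ^ n else 0)"
      using assms by (simp add: sum.distrib sum_subtractf sum_symp_sign card_pvecs)
    finally show False by (simp split: if_splits)
  qed
  then show ?thesis using that by blast
qed

section \<open>The symplectic action of the gates\<close>

text \<open>The three gates act on the exponents of X^a Z^b: H exchanges the two bits of its qubit
  (flips both if they differ), S sends X to XZ up to phase, and CNOT copies X from control to target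
  and Z from target to control. All three maps are involutions, even that of S, because S^2 = Z only
  changes signs.\<close>

definition gH :: "nat \<Rightarrow> pvec \<Rightarrow> pvec" where
  "gH j v = (if bit (fst v) j = bit (snd v) j then v else (fst v XOR 2 ^ j, snd v XOR 2 ^ j))"

definition gS :: "nat \<Rightarrow> pvec \<Rightarrow> pvec" where
  "gS j v = (fst v, if bit (fst v) j then snd v XOR 2 ^ j else snd v)"

definition gC :: "nat \<Rightarrow> nat \<Rightarrow> pvec \<Rightarrow> pvec" where
  "gC c t v = (if bit (fst v) c then fst v XOR 2 ^ t else fst v,
               if bit (snd v) t then snd v XOR 2 ^ c else snd v)"

definition gates :: "nat \<Rightarrow> (pvec \<Rightarrow> pvec) set" where
  "gates n = {gH j | j. j < n} \<union> {gS j | j. j < n} \<union> {gC c t | c t. c < n \<and> t < n \<and> c \<noteq> t}"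

lemma gate_involution: "g \<in> gates n \<Longrightarrow> g (g v) = v"
  by (auto simp: gates_def gH_def gS_def gC_def bit_xor_iff prod_eq_iff)

lemma gate_in_pvecs: "g \<in> gates n \<Longrightarrow> v \<in> pvecs n \<Longrightarrow> g v \<in> pvecs n"
  by (auto simp: gates_def gH_def gS_def gC_def pvecs_def)

lemma gate_padd: "g \<in> gates n \<Longrightarrow> g (padd v w) = padd (g v) (g w)"
  by (auto simp: gates_def gH_def gS_def gC_def padd_def bit_xor_iff xor.assoc xor.left_commute xor.commute)

lemma gate_symp_sign: "g \<in> gates n \<Longrightarrow> symp_sign n (g v) (g w) = symp_sign n v w"
  by (auto simp: gates_def gH_def gS_def gC_def symp_sign_def chi_xor_left chi_xor_right 
        chi_exp_left chi_exp_right bit_xor_iff)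

text \<open>Generated by left composition exactly as \<open>clifford\<close> is by left
  multiplication, so that the two can be matched by parallel inductions.\<close>

inductive_set sympl :: "nat \<Rightarrow> (pvec \<Rightarrow> pvec) set" for n where
  sympl_id: "id \<in> sympl n"
| sympl_gate: "h \<in> sympl n \<Longrightarrow> g \<in> gates n \<Longrightarrow> g \<circ> h \<in> sympl n"

lemma gate_in_sympl: "g \<in> gates n \<Longrightarrow> g \<in> sympl n"
  using sympl_gate[OF sympl_id] by simp

lemma sympl_comp: "g \<in> sympl n \<Longrightarrow> h \<in> sympl n \<Longrightarrow> g \<circ> h \<in> sympl n"
  by (induction rule: sympl.induct) (auto simp: comp_assoc intro: sympl.intros)

lemma sympl_symp_sign: "h \<in> sympl n \<Longrightarrow> symp_sign n (h v) (h w) = symp_sign n v w"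
  by (induction arbitrary: v w rule: sympl.induct) (auto simp: gate_symp_sign)

lemma gate_pzero: "g \<in> gates n \<Longrightarrow> g pzero = pzero"
  by (auto simp: gates_def gH_def gS_def gC_def)

lemma sympl_pzero: "h \<in> sympl n \<Longrightarrow> h pzero = pzero"
  by (induction rule: sympl.induct) (auto simp: gate_pzero)

lemma sympl_bij: "h \<in> sympl n \<Longrightarrow> bij_betw h (pvecs n) (pvecs n)"
proof (induction rule: sympl.induct)
  case (sympl_gate h g)
  have "bij_betw g (pvecs n) (pvecs n)"
    by (rule bij_betwI[where g=g]) (use sympl_gate gate_involution gate_in_pvecs in auto)
  with sympl_gate.IH show ?case by (rule bij_betw_trans)
qed (simp add: bij_betw_def)

section \<open>Transvections and transitivity\<close>

definition transv :: "nat \<Rightarrow> pvec \<Rightarrow> pvec \<Rightarrow> pvec" where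
  "transv n u v = (if symp_sign n u v = - 1 then padd v u else v)"

text \<open>Conjugating a transvection by a symplectic map moves its vector; the right-hand factor
  is \<open>g\<close> again because a gate map is its own inverse.\<close>

lemma transv_gate:
  assumes "g \<in> gates n"
  shows "transv n (g u) = g \<circ> transv n u \<circ> g"
proof
  fix v
  have "symp_sign n (g u) v = symp_sign n u (g v)"
    using gate_symp_sign[OF assms, of u "g v"] by (simp add: gate_involution[OF assms])
  then show "transv n (g u) v = (g \<circ> transv n u \<circ> g) v"
    by (simp add: transv_def gate_padd[OF assms] gate_involution[OF assms])
qed

lemma transv_gate_iff:
  assumes "g \<in> gates n"
  shows "transv n (g u) \<in> sympl n \<longleftrightarrow> transv n u \<in> sympl n"
proof -
  have "transv n u \<in> sympl n \<Longrightarrow> transv n (g u) \<in> sympl n" for u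
    by (simp add: transv_gate[OF assms] sympl_comp gate_in_sympl assms)
  from this[of u] this[of "g u"] show ?thesis
    by (auto simp: gate_involution[OF assms])
qed

text \<open>Transvections are conjugated into each other by gates. At a set bit of \<open>b\<close> a gate \<open>S\<close> or \<open>H\<close>
  clears that bit; once \<open>b = 0\<close>, a CNOT removes a bit of \<open>a\<close>, down to a single one.\<close>

lemma transv_in_sympl:
  assumes "u \<in> pvecs n"
  shows "transv n u \<in> sympl n"
  using assms
\<comment> \<open>Bits of \<open>b\<close> weigh twice as much because H clears a bit of
  \<open>b\<close> at the price of setting one of \<open>a\<close>.\<close>
proof (induction u rule: measure_induct_rule[where f="\<lambda>u. 2 * card {k. k < n \<and> bit (snd u) k} + card {k. k < n \<and> bit (fst u) k}"])
  case (less u)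
  obtain a b where u: "u = (a, b)" by (cases u)
  have ab: "a < 2 ^ n" "b < 2 ^ n" using less.prems by (auto simp: u pvecs_def)
  have flip_off: "card {k. k < n \<and> bit (x XOR 2 ^ j) k} < card {k. k < n \<and> bit x k}"
    if "bit x j" "j < n" for x j :: nat
    using that by (intro psubset_card_mono) (auto simp: bit_xor_iff)
  have flip_on: "card {k. k < n \<and> bit (x XOR 2 ^ j) k} = Suc (card {k. k < n \<and> bit x k})"
    if "\<not> bit x j" "j < n" for x j :: nat
  proof -
    have "{k. k < n \<and> bit (x XOR 2 ^ j) k} = insert j {k. k < n \<and> bit x k}"
      using that by (auto simp: bit_xor_iff)
    then show ?thesis using that by simp
  qed
  consider (bb) j where "bit b j" | (b0) "b = 0" "a = 0" | (one) j where "b = 0" "a = 2 ^ j" "j < n"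
    | (two) j k where "b = 0" "bit a j" "bit a k" "j \<noteq> k"
  proof (cases "b = 0")
    case False
    then obtain j where "bit b j" by (metis bit_0_eq bit_eq_iff bot_apply bot_bool_def)
    then show ?thesis by (rule bb)
  next
    case b: True
    show ?thesis
    proof (cases "a = 0")
      case False
      then obtain j where j: "bit a j" by (metis bit_0_eq bit_eq_iff bot_apply bot_bool_def)
      show ?thesis
      proof (cases "\<exists>k. bit a k \<and> j \<noteq> k")
        case False
        then have "bit a m \<longleftrightarrow> m = j" for m using j by blast
        then have "a = 2 ^ j" by (intro bit_eqI) simp
        moreover have "j < n" using j ab by (simp add: less_exp_iff_bits)
        ultimately show ?thesis by (rule one[OF b])
      next
        case True
        then obtain k where "bit a k" "j \<noteq> k" by blast
        then show ?thesis by (rule two[OF b j])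
      qed
    qed (rule b0[OF b])
  qed
  then show ?case
  proof cases
    case bb
    then have j: "j < n" using ab by (auto simp: less_exp_iff_bits)
    define g where "g = (if bit a j then gS j else gH j)"
    have g: "g \<in> gates n" using j by (auto simp: g_def gates_def)
    have "transv n (g u) \<in> sympl n"
      by (rule less.IH) (use bb j flip_off[OF bb j] gate_in_pvecs[OF g less.prems] in
        \<open>auto simp: g_def u gS_def gH_def flip_on\<close>)
    then show ?thesis by (simp add: transv_gate_iff[OF g])
  next
    case b0
    then have "transv n u = id" by (auto simp: transv_def u)
    then show ?thesis by (metis sympl_id)
  next
    case one
    have g: "gH j \<in> gates n" using one by (auto simp: gates_def)
    \<comment> \<open>The base case: the action of S on qubit \<open>j\<close> is itself the
      transvection along Z_j, and H turns X_j into Z_j.\<close>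
    have "gS j = transv n (gH j u)"
      using one by (auto simp: fun_eq_iff gS_def gH_def transv_def symp_sign_def u chi_exp_left padd_def)
    moreover have "gS j \<in> sympl n" using one by (intro gate_in_sympl) (auto simp: gates_def)
    ultimately show ?thesis using transv_gate_iff[OF g] by metis
  next
    case two
    then have jk: "j < n" "k < n" using ab by (auto simp: less_exp_iff_bits)
    have g: "gC j k \<in> gates n" using jk two by (auto simp: gates_def)
    have "transv n (gC j k u) \<in> sympl n"
      by (rule less.IH) (use two flip_off[OF two(3) jk(2)] gate_in_pvecs[OF g less.prems] in
        \<open>auto simp: u gC_def\<close>)
    then show ?thesis by (simp add: transv_gate_iff[OF g])
  qed
qed

text \<open>If \<open>v\<close> and \<open>w\<close> anticommute, the transvection along v + w sends
  \<open>v\<close> to \<open>w\<close>, and it fixes \<open>p\<close> because \<open>p\<close> has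
  the same sign against both. If they commute, two such moves pass through a vector \<open>r\<close>
  that anticommutes with both and commutes with \<open>p\<close>. With \<open>p\<close> the zero
  vector this is plain transitivity.\<close>

lemma sympl_transitive_fixing:
  assumes K: "p \<in> pvecs n" "v \<in> pvecs n" "w \<in> pvecs n" "v \<noteq> pzero" "w \<noteq> pzero"
    and p: "symp_sign n p v = 1" "symp_sign n p w = 1" "p \<noteq> v" "p \<noteq> w"
  shows "\<exists>h\<in>sympl n. h p = p \<and> h v = w"
proof -
  have step: "\<exists>h\<in>sympl n. h p = p \<and> h v = w" 
    if "v \<in> pvecs n" "w \<in> pvecs n" "symp_sign n v w = - 1" "symp_sign n p v = symp_sign n p w" for v w
  proof (rule bexI[where x="transv n (padd v w)"])
    show "transv n (padd v w) \<in> sympl n" using that by (simp add: transv_in_sympl)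
    have "symp_sign n (padd v w) p = 1" 
      using that symp_sign_commute[of n v p] symp_sign_commute[of n w p] by (simp add: symp_sign_padd_left)
    moreover have "symp_sign n (padd v w) v = - 1"
      using that by (simp add: symp_sign_padd_left symp_sign_commute[of _ w v])
    ultimately show "transv n (padd v w) p = p \<and> transv n (padd v w) v = w"
      by (simp add: transv_def)
  qed
  show ?thesis
  proof (cases "v = w \<or> symp_sign n v w = - 1")
    case True
    then show ?thesis
    proof
      assume "v = w"
      then show ?thesis by (intro bexI[OF _ sympl_id]) simp
    next
      assume "symp_sign n v w = - 1"
      then show ?thesis using step[of v w] K p by simp
    qed
  next
    case False
    obtain r where r: "r \<in> pvecs n" "symp_sign n v r = - 1" "symp_sign n w r = - 1" "symp_sign n p r = 1"
    proof (cases "p = pzero")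
      case True
      with exists_anticommuting_pair[OF K(2-5)] that show ?thesis by auto
    next
      case pz: False
      with exists_anticommuting_pair_commuting[OF K pz p(3,4)] False that show ?thesis by auto
    qed
    obtain h1 where h1: "h1 \<in> sympl n" "h1 p = p" "h1 v = r"
      using step[of v r] r K p by auto
    obtain h2 where h2: "h2 \<in> sympl n" "h2 p = p" "h2 r = w"
      using step[of r w] r K p by (auto simp: symp_sign_commute)
    show ?thesis by (rule bexI[where x="h2 \<circ> h1"]) (use h1 h2 sympl_comp in auto)
  qed
qed

lemma sympl_transitive:
  assumes "v \<in> pvecs n" "w \<in> pvecs n" "v \<noteq> pzero" "w \<noteq> pzero"
  shows "\<exists>h\<in>sympl n. h v = w"
  using sympl_transitive_fixing[of pzero n v w] assms by auto

section \<open>Matrices and Clifford gates\<close>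

lemma supp_matD: "supp_mat d A \<Longrightarrow> \<not> (i < d \<and> j < d) \<Longrightarrow> A i j = 0"
  by (auto simp: supp_mat_def not_less)

lemma supp_mat_eqI: "supp_mat d A \<Longrightarrow> supp_mat d B \<Longrightarrow> (\<And>i j. i < d \<Longrightarrow> j < d \<Longrightarrow> A i j = B i j) \<Longrightarrow> A = B"
  by (rule ext, rule ext) (metis supp_matD)

lemma supp_ops [simp]: "supp_mat d (mmul d A B)" "supp_mat d (madd d A B)" "supp_mat d (msmult d c A)"
  "supp_mat d (dag d A)" "supp_mat d (idm d)"
  by (auto simp: supp_mat_def mmul_def madd_def msmult_def dag_def idm_def)

lemma mmul_entry: "i < d \<Longrightarrow> j < d \<Longrightarrow> mmul d A B i j = (\<Sum>k<d. A i k * B k j)"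
  by (simp add: mmul_def)

lemma msmult_entry: "i < d \<Longrightarrow> j < d \<Longrightarrow> msmult d c A i j = c * A i j"
  by (simp add: msmult_def)

lemma dag_entry: "i < d \<Longrightarrow> j < d \<Longrightarrow> dag d A i j = cnj (A j i)"
  by (simp add: dag_def)

lemma mmul_assoc: "mmul d (mmul d A B) C = mmul d A (mmul d B C)"
proof (rule supp_mat_eqI[where d=d])
  fix i j assume ij: "i < d" "j < d"
  have "mmul d (mmul d A B) C i j = (\<Sum>k<d. \<Sum>l<d. A i l * B l k * C k j)"
    using ij by (simp add: mmul_entry sum_distrib_right)
  also have "\<dots> = (\<Sum>l<d. \<Sum>k<d. A i l * B l k * C k j)" by (rule sum.swap)
  also have "\<dots> = mmul d A (mmul d B C) i j"
    using ij by (simp add: mmul_entry sum_distrib_left mult.assoc)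
  finally show "mmul d (mmul d A B) C i j = mmul d A (mmul d B C) i j" .
qed auto

lemma mmul_idm_left: "supp_mat d A \<Longrightarrow> mmul d (idm d) A = A"
  by (rule supp_mat_eqI[where d=d]) (auto simp: mmul_entry idm_def if_distrib[of "\<lambda>x. x * _"] cong: if_cong)

lemma mmul_idm_right: "supp_mat d A \<Longrightarrow> mmul d A (idm d) = A"
  by (rule supp_mat_eqI[where d=d]) (auto simp: mmul_entry idm_def if_distrib[of "\<lambda>x. _ * x"] cong: if_cong)

lemma mmul_msmult_left: "mmul d (msmult d c A) B = msmult d c (mmul d A B)"
  by (rule supp_mat_eqI[where d=d]) (auto simp: mmul_entry msmult_entry sum_distrib_left mult.assoc)

lemma mmul_msmult_right: "mmul d A (msmult d c B) = msmult d c (mmul d A B)"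
  by (rule supp_mat_eqI[where d=d]) (auto simp: mmul_entry msmult_entry sum_distrib_left mult_ac)

lemma msmult_msmult: "msmult d c (msmult d c' A) = msmult d (c * c') A"
  by (auto simp: msmult_def fun_eq_iff)

lemma msmult_1: "supp_mat d A \<Longrightarrow> msmult d 1 A = A"
  by (rule supp_mat_eqI[where d=d]) (auto simp: msmult_entry)

lemma dag_mmul: "dag d (mmul d A B) = mmul d (dag d B) (dag d A)"
  by (rule supp_mat_eqI[where d=d]) (auto simp: mmul_entry dag_entry mult.commute)

lemma dag_idm: "dag d (idm d) = idm d"
  by (auto simp: dag_def idm_def fun_eq_iff)

lemma tr_mmul_commute: "tr d (mmul d A B) = tr d (mmul d B A)"
  by (simp add: tr_def mmul_entry) (subst sum.swap, simp add: mult.commute)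

lemma tr_msmult: "tr d (msmult d c A) = c * tr d A"
  by (simp add: tr_def msmult_def sum_distrib_left)

text \<open>\<open>weyl n (a, b)\<close> is the Pauli operator \<open>X\<^sup>a Z\<^sup>b\<close> without the phase that makes it Hermitian;
  its entries are real.\<close>

definition weyl :: "nat \<Rightarrow> pvec \<Rightarrow> cmat" where
  "weyl n v = (\<lambda>i j. if i < 2 ^ n \<and> j < 2 ^ n \<and> i = j XOR fst v then of_real (chi n (snd v) j) else 0)"

lemma supp_weyl [simp]: "supp_mat (2 ^ n) (weyl n v)"
  by (auto simp: supp_mat_def weyl_def)

lemma mmul_weyl_right:
  assumes "v \<in> pvecs n" "i < 2 ^ n" "j < 2 ^ n"
  shows "mmul (2 ^ n) A (weyl n v) i j = A i (j XOR fst v) * of_real (chi n (snd v) j)"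
proof -
  have "j XOR fst v < 2 ^ n" using assms by (auto simp: pvecs_def)
  moreover have "mmul (2 ^ n) A (weyl n v) i j = (\<Sum>k<2 ^ n. if k = j XOR fst v then A i k * of_real (chi n (snd v) j) else 0)"
    unfolding mmul_entry[OF assms(2,3)] by (rule sum.cong) (use assms in \<open>auto simp: weyl_def\<close>)
  ultimately show ?thesis by simp
qed

lemma mmul_weyl_left:
  assumes "v \<in> pvecs n" "i < 2 ^ n" "j < 2 ^ n"
  shows "mmul (2 ^ n) (weyl n v) A i j = of_real (chi n (snd v) (i XOR fst v)) * A (i XOR fst v) j"
proof -
  have "i XOR fst v < 2 ^ n" using assms by (auto simp: pvecs_def)
  moreover have "mmul (2 ^ n) (weyl n v) A i j = (\<Sum>k<2 ^ n. if k = i XOR fst v then of_real (chi n (snd v) k) * A k j else 0)"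
    unfolding mmul_entry[OF assms(2,3)] by (rule sum.cong) (use assms in \<open>auto simp: weyl_def\<close>)
  ultimately show ?thesis by simp
qed

text \<open>Conjugation with the adjoint moved to the other side, which composes along products
  without unitarity. The phase ranges over fourth roots of unity because \<open>weyl\<close> omits
  phases: S X = i (XZ) S. This restriction leaves finitely many possible conjugates of each Pauli
  operator.\<close>

definition intertw :: "nat \<Rightarrow> cmat \<Rightarrow> (pvec \<Rightarrow> pvec) \<Rightarrow> bool" where
  "intertw n U g \<longleftrightarrow> (\<forall>v\<in>pvecs n. \<exists>c. c ^ 4 = 1 \<and>
     mmul (2 ^ n) U (weyl n v) = msmult (2 ^ n) c (mmul (2 ^ n) (weyl n (g v)) U))"

lemma intertw_idm: "intertw n (idm (2 ^ n)) id"
  unfolding intertw_def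
proof
  fix v assume "v \<in> pvecs n"
  show "\<exists>c. c ^ 4 = 1 \<and> mmul (2 ^ n) (idm (2 ^ n)) (weyl n v) = msmult (2 ^ n) c (mmul (2 ^ n) (weyl n (id v)) (idm (2 ^ n)))"
    by (rule exI[of _ 1]) (simp add: mmul_idm_left mmul_idm_right msmult_1)
qed

lemma intertw_mmul:
  assumes "intertw n A g" "intertw n B h" "\<And>v. v \<in> pvecs n \<Longrightarrow> h v \<in> pvecs n"
  shows "intertw n (mmul (2 ^ n) A B) (g \<circ> h)"
  unfolding intertw_def
proof
  fix v assume v: "v \<in> pvecs n"
  let ?m = "mmul (2 ^ n)" 
  obtain c where c: "c ^ 4 = 1" "?m B (weyl n v) = msmult (2 ^ n) c (?m (weyl n (h v)) B)"
    using assms v unfolding intertw_def by blast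
  obtain c' where c': "c' ^ 4 = 1" "?m A (weyl n (h v)) = msmult (2 ^ n) c' (?m (weyl n (g (h v))) A)"
    using assms v unfolding intertw_def by blast
  have "?m (?m A B) (weyl n v) = msmult (2 ^ n) c (?m (?m A (weyl n (h v))) B)"
    by (simp add: mmul_assoc c mmul_msmult_right)
  also have "\<dots> = msmult (2 ^ n) (c * c') (?m (weyl n ((g \<circ> h) v)) (?m A B))"
    by (simp add: c' mmul_assoc mmul_msmult_left msmult_msmult)
  finally show "\<exists>c. c ^ 4 = 1 \<and> ?m (?m A B) (weyl n v) = msmult (2 ^ n) c (?m (weyl n ((g \<circ> h) v)) (?m A B))"
    using c(1) c'(1) by (intro exI[of _ "c * c'"]) (simp add: power_mult_distrib)
qed

section \<open>Intertwining relations of the gates\<close>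

lemma chi_remove:
  assumes "q < n"
  shows "chi n b j = (if bit b q \<and> bit j q then - 1 else 1) * (\<Prod>k\<in>{..<n} - {q}. if bit b k \<and> bit j k then - 1 else 1)"
  unfolding chi_def by (rule prod.remove) (use assms in simp_all)

lemma gate1_entry: 
  "i < 2 ^ n \<Longrightarrow> j < 2 ^ n \<Longrightarrow> gate1 n q g i j = (if \<forall>k<n. k \<noteq> q \<longrightarrow> bit i k = bit j k then g (of_bool (bit i q)) (of_bool (bit j q)) else 0)"
  by (simp only: gate1_def bitq_eq of_bool_eq_iff simp_thms)

lemma supp_gate1 [simp]: "supp_mat (2 ^ n) (gate1 n q g)"
  by (auto simp: supp_mat_def gate1_def)

text \<open>Away from qubit \<open>q\<close> both sides carry the same signs, so the claim reduces
  to the identity \<open>key\<close> between the entries of 2 x 2 matrices, with \<open>x\<close>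
  the row bit and \<open>y\<close> the column bit of qubit \<open>q\<close>.\<close>

lemma gate1_weyl:
  assumes q: "q < n" and v: "v \<in> pvecs n" "v' \<in> pvecs n"
    and off: "\<And>k. k < n \<Longrightarrow> k \<noteq> q \<Longrightarrow> bit (fst v') k = bit (fst v) k \<and> bit (snd v') k = bit (snd v) k"
    and key: "\<And>x y. g (of_bool x) (of_bool (y \<noteq> bit (fst v) q)) * (if bit (snd v) q \<and> y then - 1 else 1)
       = c * ((if bit (snd v') q \<and> (x \<noteq> bit (fst v') q) then - 1 else 1) * g (of_bool (x \<noteq> bit (fst v') q)) (of_bool y))"
  shows "mmul (2 ^ n) (gate1 n q g) (weyl n v) = msmult (2 ^ n) c (mmul (2 ^ n) (weyl n v') (gate1 n q g))"
proof -
  define P where "P b j = (\<Prod>k\<in>{..<n} - {q}. if bit b k \<and> bit j k then - 1 else (1::real))" for b j :: nat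
  have chi_P: "chi n b j = (if bit b q \<and> bit j q then - 1 else 1) * P b j" for b j
    unfolding P_def by (rule chi_remove[OF q])
  show ?thesis
  proof (rule supp_mat_eqI[where d="2 ^ n"])
    fix i j :: nat assume ij: "i < 2 ^ n" "j < 2 ^ n"
    have less: "j XOR fst v < 2 ^ n" "i XOR fst v' < 2 ^ n" using ij v by (auto simp: pvecs_def)
    define agree where "agree \<longleftrightarrow> (\<forall>k<n. k \<noteq> q \<longrightarrow> bit i k = bit (j XOR fst v) k)"
    have agree': "agree \<longleftrightarrow> (\<forall>k<n. k \<noteq> q \<longrightarrow> bit (i XOR fst v') k = bit j k)"
      unfolding agree_def using off by (auto simp: bit_xor_iff)
    have "mmul (2 ^ n) (gate1 n q g) (weyl n v) i j = (if agree then 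
         g (of_bool (bit i q)) (of_bool (bit j q \<noteq> bit (fst v) q)) * (if bit (snd v) q \<and> bit j q then - 1 else 1) * of_real (P (snd v) j) else 0)"
      unfolding mmul_weyl_right[OF v(1) ij] gate1_entry[OF ij(1) less(1)] agree_def[symmetric] chi_P
      by (simp add: bit_xor_iff)
    also have "\<dots> = (if agree then c *
         ((if bit (snd v') q \<and> (bit i q \<noteq> bit (fst v') q) then - 1 else 1) * g (of_bool (bit i q \<noteq> bit (fst v') q)) (of_bool (bit j q))) * of_real (P (snd v') (i XOR fst v')) else 0)"
    proof (rule if_cong[OF refl _ refl])
      assume agree
      then have "P (snd v) j = P (snd v') (i XOR fst v')"
        unfolding P_def agree' by (intro prod.cong) (use off in auto)
      then show "g (of_bool (bit i q)) (of_bool (bit j q \<noteq> bit (fst v) q)) * (if bit (snd v) q \<and> bit j q then - 1 else 1) * of_real (P (snd v) j)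
       = c * ((if bit (snd v') q \<and> (bit i q \<noteq> bit (fst v') q) then - 1 else 1) * g (of_bool (bit i q \<noteq> bit (fst v') q)) (of_bool (bit j q))) * of_real (P (snd v') (i XOR fst v'))"
        by (simp only: key)
    qed
    also have "\<dots> = msmult (2 ^ n) c (mmul (2 ^ n) (weyl n v') (gate1 n q g)) i j"
      unfolding msmult_entry[OF ij] mmul_weyl_left[OF v(2) ij] gate1_entry[OF less(2) ij(2)] agree'[symmetric] chi_P
      by (simp add: bit_xor_iff)
    finally show "mmul (2 ^ n) (gate1 n q g) (weyl n v) i j = msmult (2 ^ n) c (mmul (2 ^ n) (weyl n v') (gate1 n q g)) i j" .
  qed auto
qed

lemma intertw_hadamard:
  assumes q: "q < n"
  shows "intertw n (gate1 n q hadamard) (gH q)"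
  unfolding intertw_def
proof
  fix v assume v: "v \<in> pvecs n"
  have gv: "gH q v \<in> pvecs n" by (rule gate_in_pvecs[OF _ v]) (use q in \<open>auto simp: gates_def\<close>)
  show "\<exists>c. c ^ 4 = 1 \<and> mmul (2 ^ n) (gate1 n q hadamard) (weyl n v) = msmult (2 ^ n) c (mmul (2 ^ n) (weyl n (gH q v)) (gate1 n q hadamard))"
  proof (intro exI conjI)
    \<comment> \<open>H turns XZ into ZX, which is -XZ.\<close>
    let ?c = "if bit (fst v) q \<and> bit (snd v) q then - 1 else (1::complex)"
    show "?c ^ 4 = 1" by simp
    show "mmul (2 ^ n) (gate1 n q hadamard) (weyl n v) = msmult (2 ^ n) ?c (mmul (2 ^ n) (weyl n (gH q v)) (gate1 n q hadamard))"
    proof (rule gate1_weyl[OF q v gv])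
      fix x y
      show "hadamard (of_bool x) (of_bool (y \<noteq> bit (fst v) q)) * (if bit (snd v) q \<and> y then - 1 else 1)
       = ?c * ((if bit (snd (gH q v)) q \<and> (x \<noteq> bit (fst (gH q v)) q) then - 1 else 1) * hadamard (of_bool (x \<noteq> bit (fst (gH q v)) q)) (of_bool y))"
        by (cases x; cases y; cases "bit (fst v) q"; cases "bit (snd v) q")
           (simp_all add: gH_def bit_xor_iff hadamard_def)
    qed (simp add: gH_def bit_xor_iff)
  qed
qed

lemma intertw_sgate:
  assumes q: "q < n"
  shows "intertw n (gate1 n q sgate) (gS q)"
  unfolding intertw_def
proof
  fix v assume v: "v \<in> pvecs n"
  have gv: "gS q v \<in> pvecs n" by (rule gate_in_pvecs[OF _ v]) (use q in \<open>auto simp: gates_def\<close>)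
  show "\<exists>c. c ^ 4 = 1 \<and> mmul (2 ^ n) (gate1 n q sgate) (weyl n v) = msmult (2 ^ n) c (mmul (2 ^ n) (weyl n (gS q v)) (gate1 n q sgate))"
  proof (intro exI conjI)
    let ?c = "if bit (fst v) q then \<i> else 1"
    show "?c ^ 4 = 1" by simp
    show "mmul (2 ^ n) (gate1 n q sgate) (weyl n v) = msmult (2 ^ n) ?c (mmul (2 ^ n) (weyl n (gS q v)) (gate1 n q sgate))"
    proof (rule gate1_weyl[OF q v gv])
      fix x y
      show "sgate (of_bool x) (of_bool (y \<noteq> bit (fst v) q)) * (if bit (snd v) q \<and> y then - 1 else 1)
       = ?c * ((if bit (snd (gS q v)) q \<and> (x \<noteq> bit (fst (gS q v)) q) then - 1 else 1) * sgate (of_bool (x \<noteq> bit (fst (gS q v)) q)) (of_bool y))"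
        by (cases x; cases y; cases "bit (fst v) q"; cases "bit (snd v) q")
           (simp_all add: gS_def bit_xor_iff sgate_def)
    qed (simp add: gS_def bit_xor_iff)
  qed
qed

definition cnot_idx :: "nat \<Rightarrow> nat \<Rightarrow> nat \<Rightarrow> nat" where
  "cnot_idx c t i = (if bit i c then i XOR 2 ^ t else i)"

lemma cnot_idx_cnot_idx: "c \<noteq> t \<Longrightarrow> cnot_idx c t (cnot_idx c t i) = i"
  by (auto simp: cnot_idx_def bit_xor_iff)

lemma cnot_idx_less [simp]: "i < 2 ^ n \<Longrightarrow> t < n \<Longrightarrow> cnot_idx c t i < 2 ^ n"
  by (auto simp: cnot_idx_def)

lemma cnot_idx_xor: "cnot_idx c t (i XOR j) = cnot_idx c t i XOR cnot_idx c t j"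
  by (auto simp: cnot_idx_def bit_xor_iff xor.assoc xor.commute xor.left_commute)

lemma cnot_eq: "cnot n c t i j = (if i < 2 ^ n \<and> j < 2 ^ n \<and> i = cnot_idx c t j then 1 else 0)"
  by (simp add: cnot_def cnot_idx_def bitq_eq flipq_eq)

lemma supp_cnot [simp]: "supp_mat (2 ^ n) (cnot n c t)"
  by (auto simp: supp_mat_def cnot_def)

text \<open>CNOT permutes the basis by the XOR-linear involution \<open>cnot_idx\<close>. The X-part
  of a Pauli vector is moved by this map and the Z-part by its transpose, so the characters match
  with phase 1.\<close>

lemma intertw_cnot:
  assumes q: "c < n" "t < n" "c \<noteq> t"
  shows "intertw n (cnot n c t) (gC c t)"
  unfolding intertw_def
proof
  fix v assume v: "v \<in> pvecs n"
  have gv: "gC c t v \<in> pvecs n" by (rule gate_in_pvecs[OF _ v]) (use q in \<open>auto simp: gates_def\<close>)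
  have fst_gC: "fst (gC c t v) = cnot_idx c t (fst v)" by (simp add: gC_def cnot_idx_def)
  have "mmul (2 ^ n) (cnot n c t) (weyl n v) = msmult (2 ^ n) 1 (mmul (2 ^ n) (weyl n (gC c t v)) (cnot n c t))"
  proof (rule supp_mat_eqI[where d="2 ^ n"])
    fix i j :: nat assume ij: "i < 2 ^ n" "j < 2 ^ n"
    have less: "j XOR fst v < 2 ^ n" "i XOR fst (gC c t v) < 2 ^ n" using ij v gv by (auto simp: pvecs_def)
    have "chi n (snd (gC c t v)) (cnot_idx c t j) = chi n (snd v) j"
      using q by (auto simp: gC_def cnot_idx_def chi_xor_left chi_xor_right chi_exp_left chi_exp_right bit_xor_iff)
    moreover have "i = cnot_idx c t (j XOR fst v) \<longleftrightarrow> i XOR fst (gC c t v) = cnot_idx c t j"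
      unfolding cnot_idx_xor fst_gC by (auto simp only: xor_eq_iff)
    ultimately show "mmul (2 ^ n) (cnot n c t) (weyl n v) i j = msmult (2 ^ n) 1 (mmul (2 ^ n) (weyl n (gC c t v)) (cnot n c t)) i j"
      using ij less by (simp add: mmul_weyl_right[OF v] mmul_weyl_left[OF gv] msmult_entry cnot_eq)
  qed auto
  then show "\<exists>k. k ^ 4 = 1 \<and> mmul (2 ^ n) (cnot n c t) (weyl n v) = msmult (2 ^ n) k (mmul (2 ^ n) (weyl n (gC c t v)) (cnot n c t))"
    by (intro exI[of _ 1]) simp
qed

lemma gate1_mult:
  assumes "q < n"
  shows "mmul (2 ^ n) (gate1 n q g) (gate1 n q h) = gate1 n q (\<lambda>x y. g x 0 * h 0 y + g x 1 * h 1 y)"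
proof (rule supp_mat_eqI[where d="2 ^ n"])
  fix i j :: nat assume ij: "i < 2 ^ n" "j < 2 ^ n"
  define i' where "i' = i XOR 2 ^ q"
  have i': "i' < 2 ^ n" "i' \<noteq> i" using ij assms bit_exp_nat[of q q] by (auto simp: i'_def bit_eq_iff bit_xor_iff)
  have bits: "bit i' k \<longleftrightarrow> bit i k \<noteq> (k = q)" for k by (auto simp: i'_def bit_xor_iff)
  have "mmul (2 ^ n) (gate1 n q g) (gate1 n q h) i j = (\<Sum>k<2 ^ n. gate1 n q g i k * gate1 n q h k j)"
    using ij by (simp add: mmul_entry)
  \<comment> \<open>A one-qubit gate connects \<open>i\<close> only to indices that agree with it
    off qubit \<open>q\<close>: itself and its flip \<open>i'\<close>.\<close>
  also have "\<dots> = (\<Sum>k\<in>{i, i'}. gate1 n q g i k * gate1 n q h k j)"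
  proof (rule sum.mono_neutral_right)
    show "\<forall>k\<in>{..<2 ^ n} - {i, i'}. gate1 n q g i k * gate1 n q h k j = 0"
    proof
      fix k assume k: "k \<in> {..<2 ^ n} - {i, i'}"
      have "\<not> (\<forall>m<n. m \<noteq> q \<longrightarrow> bit i m = bit k m)"
      proof
        assume *: "\<forall>m<n. m \<noteq> q \<longrightarrow> bit i m = bit k m"
        have "k = i \<or> k = i'"
        proof (cases "bit k q = bit i q")
          case True
          then have "k = i" by (intro eq_if_bits_below[where n=n]) (use * k ij in auto)
          then show ?thesis ..
        next
          case False
          then have "k = i'" by (intro eq_if_bits_below[where n=n]) (use * k i' bits in auto)
          then show ?thesis ..
        qed
        with k show False by simp
      qed
      then have "gate1 n q g i k = 0" using gate1_entry[of i n k q g] ij k by auto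
      then show "gate1 n q g i k * gate1 n q h k j = 0" by simp
    qed
  qed (use ij i' in auto)
  also have "\<dots> = gate1 n q (\<lambda>x y. g x 0 * h 0 y + g x 1 * h 1 y) i j"
    using ij i' by (auto simp: gate1_entry bits)
  finally show "mmul (2 ^ n) (gate1 n q g) (gate1 n q h) i j = gate1 n q (\<lambda>x y. g x 0 * h 0 y + g x 1 * h 1 y) i j" .
qed auto

lemma gate1_idm:
  assumes "\<And>x y. x < 2 \<Longrightarrow> y < 2 \<Longrightarrow> g x y = (if x = y then 1 else 0)" "q < n"
  shows "gate1 n q g = idm (2 ^ n)"
proof (rule supp_mat_eqI[where d="2 ^ n"])
  fix i j :: nat assume ij: "i < 2 ^ n" "j < 2 ^ n"
  have "i = j \<longleftrightarrow> (\<forall>k<n. k \<noteq> q \<longrightarrow> bit i k = bit j k) \<and> bit i q = bit j q"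
    using eq_if_bits_below[OF ij] by auto
  then show "gate1 n q g i j = idm (2 ^ n) i j"
    using ij assms by (auto simp: gate1_entry idm_def)
qed auto

lemma dag_gate1: "dag (2 ^ n) (gate1 n q g) = gate1 n q (\<lambda>x y. cnj (g y x))"
  by (rule supp_mat_eqI[where d="2 ^ n"]) (auto simp: dag_entry gate1_entry)

section \<open>Unitarity and the correspondence with the symplectic maps\<close>

definition gate_mats :: "nat \<Rightarrow> cmat set" where
  "gate_mats n = {gate1 n j hadamard | j. j < n} \<union> {gate1 n j sgate | j. j < n}
     \<union> {cnot n c t | c t. c < n \<and> t < n \<and> c \<noteq> t}"

lemma gate_mats_clifford: "M \<in> gate_mats n \<Longrightarrow> U \<in> clifford n \<Longrightarrow> mmul (2 ^ n) M U \<in> clifford n"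
  by (auto simp: gate_mats_def intro: clifford.intros)

lemma clifford_gate_induct [consumes 1, case_names idm gate]:
  assumes "U \<in> clifford n" "P (idm (2 ^ n))"
    and "\<And>M U. M \<in> gate_mats n \<Longrightarrow> U \<in> clifford n \<Longrightarrow> P U \<Longrightarrow> P (mmul (2 ^ n) M U)"
  shows "P U"
  using assms(1)
proof (induction rule: clifford.induct)
  case cl_id
  show ?case by fact
qed (rule assms(3), auto simp: gate_mats_def)+

lemma gate_mats_intertw: "M \<in> gate_mats n \<Longrightarrow> \<exists>g\<in>gates n. intertw n M g"
  unfolding gate_mats_def gates_def using intertw_hadamard intertw_sgate intertw_cnot by blast

lemma gates_intertw: "g \<in> gates n \<Longrightarrow> \<exists>M\<in>gate_mats n. intertw n M g"
  unfolding gate_mats_def gates_def using intertw_hadamard intertw_sgate intertw_cnot by blast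

lemma less_2_nat: "x < (2::nat) \<longleftrightarrow> x = 0 \<or> x = 1"
  by auto

lemma cnot_cnot: 
  assumes "t < n" "c \<noteq> t"
  shows "mmul (2 ^ n) (cnot n c t) (cnot n c t) = idm (2 ^ n)"
proof (rule supp_mat_eqI[where d="2 ^ n"])
  fix i j :: nat assume ij: "i < 2 ^ n" "j < 2 ^ n"
  have "mmul (2 ^ n) (cnot n c t) (cnot n c t) i j = (\<Sum>k<2 ^ n. if k = cnot_idx c t j then (if i = j then 1 else 0) else 0)"
    unfolding mmul_entry[OF ij] by (rule sum.cong) (use ij assms in \<open>auto simp: cnot_eq cnot_idx_cnot_idx\<close>)
  then show "mmul (2 ^ n) (cnot n c t) (cnot n c t) i j = idm (2 ^ n) i j"
    using ij assms by (simp add: idm_def)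
qed auto

lemma dag_cnot: "c \<noteq> t \<Longrightarrow> dag (2 ^ n) (cnot n c t) = cnot n c t"
  by (auto simp: dag_def cnot_eq cnot_idx_cnot_idx fun_eq_iff)

text \<open>H and CNOT are involutions and S has order 4. The resulting identity M^4 = 1 is what
  controls the determinants of Clifford unitaries.\<close>

lemma gate_mats_unitary:
  assumes "M \<in> gate_mats n"
  shows "mmul (2 ^ n) (dag (2 ^ n) M) M = idm (2 ^ n)" "mmul (2 ^ n) M (dag (2 ^ n) M) = idm (2 ^ n)"
    and "mmul (2 ^ n) (mmul (2 ^ n) M M) (mmul (2 ^ n) M M) = idm (2 ^ n)"
proof -
  have r2: "complex_of_real (sqrt 2) * complex_of_real (sqrt 2) = 2"
    by (simp flip: of_real_mult)
  from assms consider (H) j where "M = gate1 n j hadamard" "j < n" | (S) j where "M = gate1 n j sgate" "j < n"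
    | (C) c t where "M = cnot n c t" "t < n" "c \<noteq> t" by (auto simp: gate_mats_def)
  then have "mmul (2 ^ n) (dag (2 ^ n) M) M = idm (2 ^ n) \<and> mmul (2 ^ n) M (dag (2 ^ n) M) = idm (2 ^ n)
     \<and> mmul (2 ^ n) (mmul (2 ^ n) M M) (mmul (2 ^ n) M M) = idm (2 ^ n)"
  proof cases
    case H
    have HH: "mmul (2 ^ n) M M = idm (2 ^ n)"
      using H by (auto simp: gate1_mult hadamard_def less_2_nat r2 intro!: gate1_idm)
    moreover have "dag (2 ^ n) M = M" 
      by (simp add: H dag_gate1) (rule arg_cong[where f="gate1 n j"], auto simp: fun_eq_iff hadamard_def)
    ultimately show ?thesis by (simp add: mmul_idm_left)
  next
    case S
    then show ?thesis
      by (auto simp: dag_gate1 gate1_mult sgate_def less_2_nat intro!: gate1_idm)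
  next
    case C
    then show ?thesis by (simp add: cnot_cnot dag_cnot mmul_idm_left)
  qed
  then show "mmul (2 ^ n) (dag (2 ^ n) M) M = idm (2 ^ n)" "mmul (2 ^ n) M (dag (2 ^ n) M) = idm (2 ^ n)"
    "mmul (2 ^ n) (mmul (2 ^ n) M M) (mmul (2 ^ n) M M) = idm (2 ^ n)" by auto
qed

lemma supp_clifford: "U \<in> clifford n \<Longrightarrow> supp_mat (2 ^ n) U"
  by (induction rule: clifford_gate_induct) auto

lemma clifford_unitary:
  assumes "U \<in> clifford n"
  shows "mmul (2 ^ n) (dag (2 ^ n) U) U = idm (2 ^ n) \<and> mmul (2 ^ n) U (dag (2 ^ n) U) = idm (2 ^ n)"
  using assms
proof (induction rule: clifford_gate_induct)
  case idm
  then show ?case by (simp add: dag_idm mmul_idm_left)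
next
  case (gate M U)
  let ?m = "mmul (2 ^ n)" and ?D = "dag (2 ^ n)"
  have "?m (?m (?D U) (?D M)) (?m M U) = ?m (?D U) (?m (?m (?D M) M) U)"
    by (simp add: mmul_assoc)
  moreover have "?m (?m M U) (?m (?D U) (?D M)) = ?m M (?m (?m U (?D U)) (?D M))"
    by (simp add: mmul_assoc)
  ultimately show ?case using gate 
    by (simp add: dag_mmul gate_mats_unitary mmul_idm_left supp_clifford)
qed

lemma clifford_mmul:
  assumes "U \<in> clifford n" "U' \<in> clifford n"
  shows "mmul (2 ^ n) U U' \<in> clifford n"
  using assms(1) 
  by (induction rule: clifford_gate_induct)
     (auto simp: mmul_idm_left supp_clifford assms(2) mmul_assoc gate_mats_clifford)

lemma clifford_intertw: "U \<in> clifford n \<Longrightarrow> \<exists>g\<in>sympl n. intertw n U g"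
proof (induction rule: clifford_gate_induct)
  case idm
  show ?case using intertw_idm sympl.sympl_id by blast
next
  case (gate M U)
  then obtain g h where gh: "g \<in> gates n" "intertw n M g" "h \<in> sympl n" "intertw n U h"
    using gate_mats_intertw by blast
  have "intertw n (mmul (2 ^ n) M U) (g \<circ> h)"
    using gh sympl_bij[of h n] by (intro intertw_mmul) (auto simp: bij_betw_def)
  then show ?case using gh sympl_gate by blast
qed

text \<open>Every symplectic map in the orbit arguments is realised by a Clifford matrix; this is
  what turns transitivity on vectors into symmetry of averages over the group.\<close>

lemma sympl_intertw: "h \<in> sympl n \<Longrightarrow> \<exists>U\<in>clifford n. intertw n U h"
proof (induction rule: sympl.induct)
  case sympl_id
  show ?case using intertw_idm clifford.cl_id by blast
next
  case (sympl_gate h g)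
  then obtain U M where UM: "U \<in> clifford n" "intertw n U h" "M \<in> gate_mats n" "intertw n M g"
    using gates_intertw by blast
  have "intertw n (mmul (2 ^ n) M U) (g \<circ> h)"
    using UM sympl_bij[OF sympl_gate(1)] by (intro intertw_mmul) (auto simp: bij_betw_def)
  then show ?case using UM gate_mats_clifford by blast
qed

section \<open>Finiteness of the Clifford group\<close>

text \<open>A transfer to matrices with a carrier, where determinants are available.\<close>

definition jmat :: "nat \<Rightarrow> cmat \<Rightarrow> complex mat" where
  "jmat d A = Matrix.mat d d (\<lambda>(i, j). A i j)"

lemma jmat_carrier [simp]: "jmat d A \<in> carrier_mat d d"
  by (simp add: jmat_def)

lemma jmat_mmul: "jmat d (mmul d A B) = jmat d A * jmat d B"
  by (rule eq_matI) (auto simp: jmat_def mmul_entry scalar_prod_def atLeast0LessThan)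

lemma jmat_idm: "jmat d (idm d) = 1\<^sub>m d"
  by (rule eq_matI) (auto simp: jmat_def idm_def)

lemma det_jmat_mmul: "Determinant.det (jmat d (mmul d A B)) = Determinant.det (jmat d A) * Determinant.det (jmat d B)"
  by (simp add: jmat_mmul det_mult[of _ d])

lemma det_jmat_msmult: "Determinant.det (jmat d (msmult d c A)) = c ^ d * Determinant.det (jmat d A)"
proof -
  have "jmat d (msmult d c A) = c \<cdot>\<^sub>m jmat d A"
    by (rule eq_matI) (auto simp: jmat_def msmult_entry)
  then show ?thesis by (simp add: jmat_def)
qed

lemma det_clifford: "U \<in> clifford n \<Longrightarrow> Determinant.det (jmat (2 ^ n) U) ^ 4 = 1"
proof (induction rule: clifford_gate_induct)
  case idm
  show ?case by (simp add: jmat_idm)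
next
  case (gate M U)
  have "Determinant.det (jmat (2 ^ n) M) ^ 4 = Determinant.det (jmat (2 ^ n) (mmul (2 ^ n) (mmul (2 ^ n) M M) (mmul (2 ^ n) M M)))"
    by (simp add: det_jmat_mmul power4_eq_xxxx)
  also have "\<dots> = 1" by (simp add: gate_mats_unitary[OF gate(1)] jmat_idm)
  finally show ?case using gate by (simp add: det_jmat_mmul power_mult_distrib)
qed

lemma clifford_conj_weyl:
  assumes "U \<in> clifford n" "v \<in> pvecs n" "intertw n U g"
  obtains c where "c ^ 4 = 1" "mmul (2 ^ n) (mmul (2 ^ n) U (weyl n v)) (dag (2 ^ n) U) = msmult (2 ^ n) c (weyl n (g v))"
proof -
  obtain c where c: "c ^ 4 = 1" "mmul (2 ^ n) U (weyl n v) = msmult (2 ^ n) c (mmul (2 ^ n) (weyl n (g v)) U)"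
    using assms unfolding intertw_def by blast
  have "mmul (2 ^ n) (mmul (2 ^ n) U (weyl n v)) (dag (2 ^ n) U) = msmult (2 ^ n) c (mmul (2 ^ n) (weyl n (g v)) (mmul (2 ^ n) U (dag (2 ^ n) U)))"
    by (simp add: c mmul_msmult_left mmul_assoc)
  then show ?thesis using that c clifford_unitary[OF assms(1)] by (simp add: mmul_idm_right)
qed

text \<open>Fourier inversion in the Z-exponent: the signed sum of the operators X^(j + l) Z^b over
  b is d |j><l|, and the conjugate of that matrix unit has the products of entries of
  \<open>U\<close> as its entries.\<close>

lemma entry_products_from_conj_weyl:
  assumes "i < 2 ^ n" "j < 2 ^ n" "k < 2 ^ n" "l < 2 ^ n"
  shows "(\<Sum>b<2 ^ n. of_real (chi n b l) * mmul (2 ^ n) (mmul (2 ^ n) U (weyl n (j XOR l, b))) (dag (2 ^ n) U) i k)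
     = 2 ^ n * (U i j * cnj (U k l))"
proof -
  have "(\<Sum>b<2 ^ n. of_real (chi n b l) * mmul (2 ^ n) (mmul (2 ^ n) U (weyl n (j XOR l, b))) (dag (2 ^ n) U) i k)
    = (\<Sum>b<2 ^ n. \<Sum>m<2 ^ n. of_real (chi n b l) * (U i (m XOR (j XOR l)) * of_real (chi n b m) * cnj (U k m)))"
  proof (rule sum.cong[OF refl])
    fix b assume "b \<in> {..<(2::nat) ^ n}"
    then have v: "(j XOR l, b) \<in> pvecs n" using assms by (auto simp: pvecs_def)
    show "of_real (chi n b l) * mmul (2 ^ n) (mmul (2 ^ n) U (weyl n (j XOR l, b))) (dag (2 ^ n) U) i k
       = (\<Sum>m<2 ^ n. of_real (chi n b l) * (U i (m XOR (j XOR l)) * of_real (chi n b m) * cnj (U k m)))"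
      unfolding mmul_entry[OF assms(1,3), of "mmul (2 ^ n) U (weyl n (j XOR l, b))"] sum_distrib_left
      by (rule sum.cong[OF refl]) (use assms in \<open>simp add: mmul_weyl_right[OF v] dag_entry\<close>)
  qed
  also have "\<dots> = (\<Sum>m<2 ^ n. \<Sum>b<2 ^ n. (U i (m XOR (j XOR l)) * cnj (U k m)) * of_real (chi n b l * chi n b m))"
    by (subst sum.swap) (simp add: mult_ac)
  also have "\<dots> = (\<Sum>m<2 ^ n. (U i (m XOR (j XOR l)) * cnj (U k m)) * of_real (if l = m then 2 ^ n else 0))"
    by (rule sum.cong[OF refl]) (use assms in \<open>simp add: sum_distrib_left[symmetric] of_real_sum[symmetric] sum_chi_chi' del: of_real_sum of_real_mult\<close>)
  also have "\<dots> = (\<Sum>m<2 ^ n. if m = l then 2 ^ n * (U i j * cnj (U k l)) else 0)"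
    by (rule sum.cong[OF refl]) auto
  finally show ?thesis using assms by simp
qed

lemma finite_if_finite_fibres:
  assumes "finite (f ` A)" "\<And>a. a \<in> A \<Longrightarrow> finite {x\<in>A. f x = f a}"
  shows "finite A"
proof -
  have "A \<subseteq> (\<Union>t\<in>f ` A. {x\<in>A. f x = t})" by auto
  moreover have "finite (\<Union>t\<in>f ` A. {x\<in>A. f x = t})" using assms by (intro finite_UN_I) auto
  ultimately show ?thesis by (rule finite_subset)
qed

text \<open>The conjugates of the Pauli operators determine \<open>U\<close> up to a scalar \<open>c\<close>, and the fourth power of
  the determinant being 1 makes \<open>c\<close> a root of unity of order dividing \<open>4 * 2 ^ n\<close>.\<close>

lemma finite_clifford: "finite (clifford n)"
proof -
  let ?d = "(2::nat) ^ n" and ?m = "mmul (2 ^ n)" and ?R = "{c::complex. c ^ 4 = 1}"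
  define D where "D U = restrict (\<lambda>v. ?m (?m U (weyl n v)) (dag ?d U)) (pvecs n)" for U
  show ?thesis
  proof (rule finite_if_finite_fibres[where f=D])
    have "finite ?R" by (rule finite_roots_unity) simp
    then have "finite ((\<lambda>(c, w). msmult ?d c (weyl n w)) ` (?R \<times> pvecs n))" by simp
    then have "finite (pvecs n \<rightarrow>\<^sub>E ((\<lambda>(c, w). msmult ?d c (weyl n w)) ` (?R \<times> pvecs n)))"
      by (intro finite_PiE) auto
    moreover have "D ` clifford n \<subseteq> (pvecs n \<rightarrow>\<^sub>E ((\<lambda>(c, w). msmult ?d c (weyl n w)) ` (?R \<times> pvecs n)))"
    proof (rule image_subsetI)
      fix U assume U: "U \<in> clifford n"
      obtain g where g: "g \<in> sympl n" "intertw n U g" using clifford_intertw[OF U] by blast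
      have gV: "g v \<in> pvecs n" if "v \<in> pvecs n" for v using that sympl_bij[OF g(1)] by (auto simp: bij_betw_def)
      show "D U \<in> (pvecs n \<rightarrow>\<^sub>E ((\<lambda>(c, w). msmult ?d c (weyl n w)) ` (?R \<times> pvecs n)))"
      proof (rule PiE_I)
        fix v assume v: "v \<in> pvecs n"
        obtain c where "c ^ 4 = 1" "?m (?m U (weyl n v)) (dag ?d U) = msmult ?d c (weyl n (g v))"
          using clifford_conj_weyl[OF U v g(2)] .
        then show "D U v \<in> (\<lambda>(c, w). msmult ?d c (weyl n w)) ` (?R \<times> pvecs n)"
          using v gV[OF v] by (auto simp: D_def intro!: image_eqI[where x="(c, g v)"])
      qed (simp add: D_def)
    qed
    ultimately show "finite (D ` clifford n)" by (rule finite_subset[rotated])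
  next
    fix U0 assume U0: "U0 \<in> clifford n"
    have "idm ?d 0 0 = (\<Sum>k<?d. U0 0 k * cnj (U0 0 k))"
      using clifford_unitary[OF U0] mmul_entry[of 0 ?d 0 U0 "dag ?d U0"] by (simp add: dag_entry)
    moreover have "idm ?d 0 0 = 1" by (simp add: idm_def)
    \<comment> \<open>Row 0 of a unitary matrix has norm 1, so it has a nonzero entry. That entry is
      the reference from which the scalar \<open>c\<close> is read off.\<close>
    ultimately obtain q where q: "q < ?d" "U0 0 q \<noteq> 0"
      by (metis (no_types, lifting) lessThan_iff mult_zero_left sum.neutral zero_neq_one)
    have "{U\<in>clifford n. D U = D U0} \<subseteq> (\<lambda>c. msmult ?d c U0) ` {c. c ^ (?d * 4) = 1}"
    proof safe
      fix U assume U: "U \<in> clifford n" "D U = D U0"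
      have eq: "U i j * cnj (U k l) = U0 i j * cnj (U0 k l)" 
        if "i < ?d" "j < ?d" "k < ?d" "l < ?d" for i j k l
      proof -
        have "?m (?m U (weyl n v)) (dag ?d U) = ?m (?m U0 (weyl n v)) (dag ?d U0)" if "v \<in> pvecs n" for v
          using fun_cong[OF U(2), of v] that by (simp add: D_def)
        moreover have "(j XOR l, b) \<in> pvecs n" if "b < ?d" for b
          using that \<open>j < ?d\<close> \<open>l < ?d\<close> by (simp add: pvecs_def)
        ultimately have "2 ^ n * (U i j * cnj (U k l)) = 2 ^ n * (U0 i j * cnj (U0 k l))"
          unfolding entry_products_from_conj_weyl[OF that, symmetric] by (intro sum.cong) auto
        then show ?thesis by simp
      qed
      have nz: "U 0 q \<noteq> 0" using eq[of 0 q 0 q] q by auto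
      define c where "c = cnj (U0 0 q) / cnj (U 0 q)"
      have Uc: "U = msmult ?d c U0"
      proof (rule supp_mat_eqI[where d="?d"])
        fix i j assume "i < ?d" "j < ?d"
        then show "U i j = msmult ?d c U0 i j"
          using eq[of i j 0 q] q nz by (simp add: msmult_entry c_def field_simps)
      qed (use U supp_clifford in auto)
      have "c ^ (?d * 4) * Determinant.det (jmat ?d U0) ^ 4 = Determinant.det (jmat ?d U) ^ 4"
        by (simp add: Uc det_jmat_msmult power_mult_distrib power_mult)
      then have "c ^ (?d * 4) = 1" using det_clifford[OF U0] det_clifford[OF U(1)] by simp
      then show "U \<in> (\<lambda>c. msmult ?d c U0) ` {c. c ^ (?d * 4) = 1}" using Uc by blast
    qed
    moreover have "finite {c::complex. c ^ (?d * 4) = 1}"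
      by (rule finite_roots_unity) simp
    ultimately show "finite {U\<in>clifford n. D U = D U0}" by (rule finite_subset[OF _ finite_imageI])
  qed
qed

lemma clifford_nonempty: "clifford n \<noteq> {}"
  using clifford.cl_id by blast

lemma card_clifford_pos: "0 < card (clifford n)"
  by (simp add: card_gt_0_iff finite_clifford clifford_nonempty)

section \<open>The induced action on Pauli vectors\<close>

text \<open>A nonzero multiple of a Pauli operator determines its vector: column 0 shows the X-part
  and, its sign being +1, the scalar; the signs in the columns \<open>2 ^ k\<close> show the bits of
  the Z-part.\<close>

lemma intertw_unique:
  assumes U: "U \<in> clifford n" and g: "intertw n U g" "intertw n U h"
    and v: "v \<in> pvecs n" "g v \<in> pvecs n" "h v \<in> pvecs n"
  shows "g v = h v"
proof -
  obtain c where c: "c ^ 4 = 1" "mmul (2 ^ n) (mmul (2 ^ n) U (weyl n v)) (dag (2 ^ n) U) = msmult (2 ^ n) c (weyl n (g v))"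
    using clifford_conj_weyl[OF U v(1) g(1)] .
  obtain c' where c': "c' ^ 4 = 1" "mmul (2 ^ n) (mmul (2 ^ n) U (weyl n v)) (dag (2 ^ n) U) = msmult (2 ^ n) c' (weyl n (h v))"
    using clifford_conj_weyl[OF U v(1) g(2)] .
  have cnz: "c \<noteq> 0" using c(1) by auto
  have eq: "c * weyl n (g v) i j = c' * weyl n (h v) i j" if "i < 2 ^ n" "j < 2 ^ n" for i j
    using fun_cong[OF fun_cong[OF c'(2)], of i j] that unfolding c(2) by (simp add: msmult_entry)
  have less: "fst (g v) < 2 ^ n" using v by (auto simp: pvecs_def)
  have f: "fst (g v) = fst (h v)" and cc: "c = c'" 
    using eq[of "fst (g v)" 0] cnz less by (auto simp: weyl_def split: if_splits)
  have "snd (g v) = snd (h v)"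
  proof (rule eq_if_bits_below[where n=n])
    fix k assume k: "k < n"
    have "chi n (snd (g v)) (2 ^ k) = chi n (snd (h v)) (2 ^ k)"
      using eq[of "2 ^ k XOR fst (g v)" "2 ^ k"] k less cnz by (simp add: weyl_def f cc)
    then show "bit (snd (g v)) k = bit (snd (h v)) k" using k by (simp add: chi_exp_right split: if_splits)
  qed (use v in \<open>auto simp: pvecs_def\<close>)
  with f show ?thesis by (simp add: prod_eq_iff)
qed

text \<open>An arbitrary choice; by \<open>intertw_unique\<close> its values on
  \<open>pvecs n\<close> do not depend on it.\<close>

definition pauli_act :: "nat \<Rightarrow> cmat \<Rightarrow> pvec \<Rightarrow> pvec" where
  "pauli_act n U = (SOME g. g \<in> sympl n \<and> intertw n U g)"

lemma pauli_act: "U \<in> clifford n \<Longrightarrow> pauli_act n U \<in> sympl n" "U \<in> clifford n \<Longrightarrow> intertw n U (pauli_act n U)"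
  unfolding pauli_act_def by (metis (mono_tags, lifting) clifford_intertw someI_ex)+

lemma sympl_in_pvecs: "h \<in> sympl n \<Longrightarrow> v \<in> pvecs n \<Longrightarrow> h v \<in> pvecs n"
  using sympl_bij by (auto simp: bij_betw_def)

lemma pauli_act_mmul:
  assumes "U \<in> clifford n" "H \<in> clifford n" "h \<in> sympl n" "intertw n H h" "v \<in> pvecs n"
  shows "pauli_act n (mmul (2 ^ n) U H) v = pauli_act n U (h v)"
proof -
  have UH: "mmul (2 ^ n) U H \<in> clifford n" using assms by (simp add: clifford_mmul)
  have "intertw n (mmul (2 ^ n) U H) (pauli_act n U \<circ> h)"
    by (rule intertw_mmul[OF pauli_act(2)[OF assms(1)] assms(4) sympl_in_pvecs[OF assms(3)]])
  then have "pauli_act n (mmul (2 ^ n) U H) v = (pauli_act n U \<circ> h) v"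
    by (rule intertw_unique[OF UH pauli_act(2)[OF UH] _ assms(5)])
       (simp_all add: sympl_in_pvecs[OF pauli_act(1)] UH assms(1) assms(5) sympl_in_pvecs[OF assms(3)])
  then show ?thesis by simp
qed

section \<open>The Pauli expansion of the measured diagonal\<close>

text \<open>\<open>diag_ind n U v\<close> indicates that \<open>U\<close> conjugates the Pauli operator \<open>weyl n v\<close> to a diagonal one.\<close>

definition diag_ind :: "nat \<Rightarrow> cmat \<Rightarrow> pvec \<Rightarrow> real" where
  "diag_ind n U v = of_bool (fst (pauli_act n U v) = 0)"

text \<open>The trace of \<open>X\<close> against \<open>weyl n v\<close>, written as a Walsh
  transform of the entries with index offset \<open>fst v\<close>, so that Parseval applies to each
  offset separately.\<close>

definition pauli_coeff :: "nat \<Rightarrow> cmat \<Rightarrow> pvec \<Rightarrow> complex" where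
  "pauli_coeff n X v = (\<Sum>l<2 ^ n. of_real (chi n (snd v) l) * X l (l XOR fst v))"

lemma tr_mmul_weyl:
  assumes "v \<in> pvecs n"
  shows "tr (2 ^ n) (mmul (2 ^ n) (weyl n v) X) = pauli_coeff n X v"
proof -
  have a: "fst v < 2 ^ n" using assms by (auto simp: pvecs_def)
  have "tr (2 ^ n) (mmul (2 ^ n) (weyl n v) X) = (\<Sum>i<2 ^ n. of_real (chi n (snd v) (i XOR fst v)) * X (i XOR fst v) ((i XOR fst v) XOR fst v))"
    unfolding tr_def by (rule sum.cong) (simp_all add: mmul_weyl_left[OF assms])
  also have "\<dots> = pauli_coeff n X v" unfolding pauli_coeff_def by (rule sum_xor_reindex[OF a])
  finally show ?thesis .
qed

text \<open>Cyclicity of the trace. The phase \<open>c\<close> is chosen before \<open>X\<close>, so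
  it cancels between the coefficient of one operator and the conjugate coefficient of
  another.\<close>

lemma pauli_coeff_conj:
  assumes U: "U \<in> clifford n" and g: "g \<in> sympl n" "intertw n U g" and v: "v \<in> pvecs n"
  obtains c where "cmod c = 1" 
    "\<And>X. pauli_coeff n X v = c * pauli_coeff n (mmul (2 ^ n) (mmul (2 ^ n) U X) (dag (2 ^ n) U)) (g v)"
proof -
  let ?m = "mmul (2 ^ n)" and ?D = "dag (2 ^ n)" 
  obtain c where c: "c ^ 4 = 1" "?m U (weyl n v) = msmult (2 ^ n) c (?m (weyl n (g v)) U)"
    using g(2) v unfolding intertw_def by blast
  have "cmod c ^ 4 = 1" using c(1) by (metis norm_one norm_power)
  then have "cmod c = 1" using power_eq_imp_eq_base[of "cmod c" 4 1] by simp
  moreover have "pauli_coeff n X v = c * pauli_coeff n (?m (?m U X) (?D U)) (g v)" for X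
  proof -
    have "pauli_coeff n X v = tr (2 ^ n) (?m (?m (?D U) U) (?m (weyl n v) X))"
      using clifford_unitary[OF U] by (simp add: tr_mmul_weyl[OF v] mmul_idm_left)
    also have "\<dots> = tr (2 ^ n) (?m (?D U) (?m (?m U (weyl n v)) X))" by (simp add: mmul_assoc)
    also have "\<dots> = c * tr (2 ^ n) (?m (?D U) (?m (weyl n (g v)) (?m U X)))"
      by (simp add: c mmul_msmult_left mmul_msmult_right mmul_assoc tr_msmult)
    also have "\<dots> = c * tr (2 ^ n) (?m (weyl n (g v)) (?m (?m U X) (?D U)))"
      by (subst tr_mmul_commute) (simp add: mmul_assoc)
    finally show ?thesis using tr_mmul_weyl sympl_in_pvecs[OF g(1) v] by simp
  qed
  ultimately show ?thesis using that by blast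
qed

lemma chi_parseval:
  fixes x y :: "nat \<Rightarrow> complex"
  shows "(\<Sum>z<2 ^ n. (\<Sum>l<2 ^ n. of_real (chi n z l) * x l) * (\<Sum>m<2 ^ n. of_real (chi n z m) * y m))
    = 2 ^ n * (\<Sum>l<2 ^ n. x l * y l)"
proof -
  have "(\<Sum>z<2 ^ n. (\<Sum>l<2 ^ n. of_real (chi n z l) * x l) * (\<Sum>m<2 ^ n. of_real (chi n z m) * y m))
    = (\<Sum>z<2 ^ n. \<Sum>l<2 ^ n. \<Sum>m<2 ^ n. (x l * y m) * of_real (chi n z l * chi n z m))"
    by (simp add: sum_product mult_ac)
  also have "\<dots> = (\<Sum>l<2 ^ n. \<Sum>m<2 ^ n. \<Sum>z<2 ^ n. (x l * y m) * of_real (chi n z l * chi n z m))"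
    by (subst sum.swap, rule sum.cong[OF refl], rule sum.swap)
  also have "\<dots> = (\<Sum>l<2 ^ n. \<Sum>m<2 ^ n. (x l * y m) * of_real (if l = m then 2 ^ n else 0))"
    by (intro sum.cong[OF refl]) (simp add: sum_distrib_left[symmetric] of_real_sum[symmetric] sum_chi_chi' del: of_real_sum of_real_mult)
  also have "\<dots> = (\<Sum>l<2 ^ n. \<Sum>m<2 ^ n. if m = l then 2 ^ n * (x l * y l) else 0)"
    by (intro sum.cong[OF refl]) auto
  also have "\<dots> = 2 ^ n * (\<Sum>l<2 ^ n. x l * y l)"
    unfolding sum_distrib_left by (intro sum.cong[OF refl]) simp
  finally show ?thesis .
qed

lemma pauli_coeff_parseval_row:
  "(\<Sum>z<2 ^ n. pauli_coeff n A (a, z) * cnj (pauli_coeff n B (a, z))) = 2 ^ n * (\<Sum>l<2 ^ n. A l (l XOR a) * cnj (B l (l XOR a)))"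
  using chi_parseval[of n "\<lambda>l. A l (l XOR a)" "\<lambda>l. cnj (B l (l XOR a))"]
  by (simp add: pauli_coeff_def)

lemma sum_pvecs: "(\<Sum>v\<in>pvecs n. f v) = (\<Sum>a<2 ^ n. \<Sum>z<2 ^ n. f (a, z))"
  by (simp add: pvecs_def sum.cartesian_product)

lemma pauli_coeff_parseval:
  "(\<Sum>v\<in>pvecs n. pauli_coeff n A v * cnj (pauli_coeff n B v)) = 2 ^ n * (\<Sum>i<2 ^ n. \<Sum>j<2 ^ n. A i j * cnj (B i j))"
proof -
  have "(\<Sum>v\<in>pvecs n. pauli_coeff n A v * cnj (pauli_coeff n B v)) = 2 ^ n * (\<Sum>l<2 ^ n. \<Sum>a<2 ^ n. A l (l XOR a) * cnj (B l (l XOR a)))"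
    unfolding sum_pvecs pauli_coeff_parseval_row sum_distrib_left[symmetric] by (subst sum.swap) (rule refl)
  also have "(\<Sum>l<2 ^ n. \<Sum>a<2 ^ n. A l (l XOR a) * cnj (B l (l XOR a))) = (\<Sum>l<2 ^ n. \<Sum>j<2 ^ n. A l j * cnj (B l j))"
    by (intro sum.cong[OF refl] sum_xor_reindex') simp
  finally show ?thesis .
qed

text \<open>The diagonal of a conjugated operator corresponds to its coefficients with X-part 0.
  Parseval on that row, followed by reindexing along the symplectic map of \<open>U\<close>,
  expresses the pairing by the coefficients before conjugation.\<close>

lemma sum_conj_diag:
  assumes U: "U \<in> clifford n"
  shows "2 ^ n * (\<Sum>b<2 ^ n. conj_diag (2 ^ n) U X b * cnj (conj_diag (2 ^ n) U Y b))
    = (\<Sum>v\<in>pvecs n. of_real (diag_ind n U v) * (pauli_coeff n X v * cnj (pauli_coeff n Y v)))"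
proof -
  define g where "g = pauli_act n U"
  have g: "g \<in> sympl n" "intertw n U g" unfolding g_def using pauli_act U by auto
  let ?C = "\<lambda>X. mmul (2 ^ n) (mmul (2 ^ n) U X) (dag (2 ^ n) U)"
  have "2 ^ n * (\<Sum>b<2 ^ n. conj_diag (2 ^ n) U X b * cnj (conj_diag (2 ^ n) U Y b))
     = (\<Sum>z<2 ^ n. pauli_coeff n (?C X) (0, z) * cnj (pauli_coeff n (?C Y) (0, z)))"
    using pauli_coeff_parseval_row[of n "?C X" 0 "?C Y"] by (simp add: conj_diag_def)
  also have "\<dots> = (\<Sum>a<2 ^ n. if a = 0 then \<Sum>z<2 ^ n. pauli_coeff n (?C X) (a, z) * cnj (pauli_coeff n (?C Y) (a, z)) else 0)"
    by simp
  also have "\<dots> = (\<Sum>w\<in>pvecs n. of_bool (fst w = 0) * (pauli_coeff n (?C X) w * cnj (pauli_coeff n (?C Y) w)))"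
    unfolding sum_pvecs by (rule sum.cong) auto
  also have "\<dots> = (\<Sum>v\<in>pvecs n. of_bool (fst (g v) = 0) * (pauli_coeff n (?C X) (g v) * cnj (pauli_coeff n (?C Y) (g v))))"
    by (rule sum.reindex_bij_betw[OF sympl_bij[OF g(1)], symmetric])
  also have "\<dots> = (\<Sum>v\<in>pvecs n. of_real (diag_ind n U v) * (pauli_coeff n X v * cnj (pauli_coeff n Y v)))"
  proof (rule sum.cong[OF refl])
    fix v assume v: "v \<in> pvecs n"
    obtain c where c: "cmod c = 1" "\<And>X. pauli_coeff n X v = c * pauli_coeff n (?C X) (g v)"
      using pauli_coeff_conj[OF U g v] by blast
    have "pauli_coeff n X v * cnj (pauli_coeff n Y v) = (c * cnj c) * (pauli_coeff n (?C X) (g v) * cnj (pauli_coeff n (?C Y) (g v)))"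
      unfolding c(2)[of X] c(2)[of Y] by simp
    also have "c * cnj c = 1" using c(1) by (simp add: complex_norm_square[symmetric])
    finally show "of_bool (fst (g v) = 0) * (pauli_coeff n (?C X) (g v) * cnj (pauli_coeff n (?C Y) (g v))) = of_real (diag_ind n U v) * (pauli_coeff n X v * cnj (pauli_coeff n Y v))"
      by (simp add: diag_ind_def g_def)
  qed
  finally show ?thesis .
qed

section \<open>Counting diagonalised Pauli operators\<close>

definition joint_diag :: "nat \<Rightarrow> pvec \<Rightarrow> pvec \<Rightarrow> real" where
  "joint_diag n v w = (\<Sum>U\<in>clifford n. diag_ind n U v * diag_ind n U w)"

text \<open>Right multiplication is injective by unitarity, and an injective self-map of a finite
  set is onto; this replaces inverses, which the inductive generation does not provide
  directly.\<close>

lemma bij_betw_clifford_mmul: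
  assumes H: "H \<in> clifford n"
  shows "bij_betw (\<lambda>U. mmul (2 ^ n) U H) (clifford n) (clifford n)"
proof -
  have "inj_on (\<lambda>U. mmul (2 ^ n) U H) (clifford n)"
  proof (rule inj_onI)
    fix U U' assume U: "U \<in> clifford n" "U' \<in> clifford n" "mmul (2 ^ n) U H = mmul (2 ^ n) U' H"
    have cancel: "mmul (2 ^ n) (mmul (2 ^ n) X H) (dag (2 ^ n) H) = X" if "X \<in> clifford n" for X
      using that clifford_unitary[OF H] by (simp add: mmul_assoc mmul_idm_right supp_clifford)
    show "U = U'" using cancel[OF U(1)] unfolding U(3) cancel[OF U(2)] by (rule sym)
  qed
  moreover have "(\<lambda>U. mmul (2 ^ n) U H) ` clifford n \<subseteq> clifford n" using H clifford_mmul by blast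
  ultimately show ?thesis unfolding bij_betw_def by (simp add: endo_inj_surj[OF finite_clifford])
qed

lemma joint_diag_sympl:
  assumes h: "h \<in> sympl n" and v: "v \<in> pvecs n" "w \<in> pvecs n"
  shows "joint_diag n (h v) (h w) = joint_diag n v w"
proof -
  obtain H where H: "H \<in> clifford n" "intertw n H h" using sympl_intertw[OF h] by blast
  have "joint_diag n v w = (\<Sum>U\<in>clifford n. diag_ind n (mmul (2 ^ n) U H) v * diag_ind n (mmul (2 ^ n) U H) w)"
    unfolding joint_diag_def by (rule sum.reindex_bij_betw[OF bij_betw_clifford_mmul[OF H(1)], symmetric])
  also have "\<dots> = joint_diag n (h v) (h w)"
    unfolding joint_diag_def by (rule sum.cong) (simp_all add: diag_ind_def pauli_act_mmul[OF _ H(1) h H(2)] v)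
  finally show ?thesis ..
qed

lemma diag_ind_sq [simp]: "diag_ind n U v * diag_ind n U v = diag_ind n U v"
  by (cases "fst (pauli_act n U v) = 0") (simp_all add: diag_ind_def)

lemma diag_ind_pzero: "U \<in> clifford n \<Longrightarrow> diag_ind n U pzero = 1"
  by (simp add: diag_ind_def sympl_pzero[OF pauli_act(1)])

lemma sum_diag_ind:
  assumes U: "U \<in> clifford n"
  shows "(\<Sum>v\<in>pvecs n. diag_ind n U v) = 2 ^ n"
proof -
  have "(\<Sum>v\<in>pvecs n. diag_ind n U v) = (\<Sum>w\<in>pvecs n. of_bool (fst w = 0))"
    unfolding diag_ind_def by (rule sum.reindex_bij_betw[OF sympl_bij[OF pauli_act(1)[OF U]]])
  also have "\<dots> = (\<Sum>a<(2::nat) ^ n. if a = 0 then 2 ^ n else (0::real))"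
    unfolding sum_pvecs by (rule sum.cong) auto
  finally show ?thesis by simp
qed

lemma diag_ind_symp_sign:
  assumes U: "U \<in> clifford n" and "symp_sign n v w \<noteq> 1"
  shows "diag_ind n U v * diag_ind n U w = 0"
proof (rule ccontr)
  assume "diag_ind n U v * diag_ind n U w \<noteq> 0"
  then have "fst (pauli_act n U v) = 0" "fst (pauli_act n U w) = 0" by (auto simp: diag_ind_def split: if_splits)
  then have "symp_sign n (pauli_act n U v) (pauli_act n U w) = 1" by (simp add: symp_sign_def)
  with assms sympl_symp_sign[OF pauli_act(1)[OF U], of v w] show False by simp
qed

lemma joint_diag_symp_sign: "symp_sign n v w \<noteq> 1 \<Longrightarrow> joint_diag n v w = 0"
  unfolding joint_diag_def by (rule sum.neutral) (simp add: diag_ind_symp_sign)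

text \<open>Each \<open>U\<close> that diagonalises \<open>v\<close> diagonalises exactly d - 1
  nonzero vectors.\<close>

lemma sum_joint_diag_right:
  "(\<Sum>w\<in>pvecs n - {pzero}. joint_diag n v w) = (2 ^ n - 1) * joint_diag n v v"
proof -
  have "(\<Sum>w\<in>pvecs n - {pzero}. joint_diag n v w) = (\<Sum>U\<in>clifford n. diag_ind n U v * (\<Sum>w\<in>pvecs n - {pzero}. diag_ind n U w))"
    unfolding joint_diag_def by (subst sum.swap) (simp add: sum_distrib_left)
  also have "\<dots> = (\<Sum>U\<in>clifford n. diag_ind n U v * (2 ^ n - 1))"
    by (rule sum.cong) (simp_all add: sum_diff1 sum_diag_ind diag_ind_pzero)
  also have "\<dots> = (2 ^ n - 1) * joint_diag n v v"
    unfolding joint_diag_def diag_ind_sq sum_distrib_left by (rule sum.cong) (simp_all add: mult.commute)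
  finally show ?thesis .
qed

text \<open>By transitivity the count is the same for all d^2 - 1 nonzero vectors, and each
  \<open>U\<close> diagonalises d - 1 of them, which leaves the fraction 1 / (d + 1).\<close>

lemma joint_diag_self:
  assumes v: "v \<in> pvecs n" "v \<noteq> pzero"
  shows "joint_diag n v v = card (clifford n) / (2 ^ n + 1)"
proof -
  have n: "(2::real) ^ n > 1" 
  proof -
    have "n \<noteq> 0" using v by (auto simp: pvecs_def)
    then show ?thesis by (simp add: one_less_power)
  qed
  have "joint_diag n w w = joint_diag n v v" if "w \<in> pvecs n - {pzero}" for w
    using sympl_transitive[of v n w] joint_diag_sympl[of _ n v v] v that by force
  then have "(\<Sum>w\<in>pvecs n - {pzero}. joint_diag n w w) = (2 ^ n * 2 ^ n - 1) * joint_diag n v v"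
    using card_pvecs[of n] by (simp add: of_nat_diff card_Diff_singleton)
  moreover have "(\<Sum>w\<in>pvecs n - {pzero}. joint_diag n w w) = (\<Sum>U\<in>clifford n. (\<Sum>w\<in>pvecs n - {pzero}. diag_ind n U w))"
    unfolding joint_diag_def by (subst sum.swap) simp
  moreover have "\<dots> = (\<Sum>U\<in>clifford n. 2 ^ n - 1)"
    by (rule sum.cong) (simp_all add: sum_diff1 sum_diag_ind diag_ind_pzero)
  ultimately have *: "(2 ^ n - 1) * ((2 ^ n + 1) * joint_diag n v v) = (2 ^ n - 1) * real (card (clifford n))"
    by (simp add: algebra_simps)
  have "(2::real) ^ n - 1 \<noteq> 0" "(2::real) ^ n + 1 \<noteq> 0" using n by linarith+
  moreover from this * have "(2 ^ n + 1) * joint_diag n v v = card (clifford n)"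
    using mult_left_cancel by blast
  ultimately show ?thesis by (simp add: eq_divide_eq mult.commute)
qed

text \<open>With \<open>v\<close> fixed, the count is constant over the d^2/2 - 2 commuting vectors
  other than 0 and \<open>v\<close>, while the total over them is (d - 2)
  \<open>joint_diag n v v\<close>. The quotient is 2 / (d + 2).\<close>

lemma joint_diag_commuting:
  assumes v: "v \<in> pvecs n" "v \<noteq> pzero" and w: "w \<in> pvecs n" "w \<noteq> pzero" and vw: "v \<noteq> w" "symp_sign n v w = 1"
  shows "joint_diag n v w = 2 * card (clifford n) / ((2 ^ n + 1) * (2 ^ n + 2))"
proof -
  let ?D = "pvecs n - {pzero} - {v}" and ?d = "(2::real) ^ n"
  have const: "joint_diag n v u = joint_diag n v w" if "u \<in> ?D" "symp_sign n v u = 1" for u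
    using sympl_transitive_fixing[of v n w u] joint_diag_sympl[of _ n v w] v w vw that by force
  \<comment> \<open>1 + S(v, u) is twice the indicator of commuting; anticommuting \<open>u\<close>
    contribute 0 on both sides.\<close>
  have "2 * (\<Sum>u\<in>?D. joint_diag n v u) = (\<Sum>u\<in>?D. (1 + symp_sign n v u) * joint_diag n v w)"
    unfolding sum_distrib_left
  proof (rule sum.cong[OF refl])
    fix u assume u: "u \<in> ?D"
    show "2 * joint_diag n v u = (1 + symp_sign n v u) * joint_diag n v w"
    proof (cases "symp_sign n v u = 1")
      case True
      then show ?thesis using const[OF u] by simp
    next
      case False
      then show ?thesis using symp_sign_cases[of n v u] joint_diag_symp_sign[of n v u] by simp
    qed
  qed
  also have "\<dots> = (\<Sum>u\<in>?D. 1 + symp_sign n v u) * joint_diag n v w"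
    by (simp add: sum_distrib_right)
  also have "(\<Sum>u\<in>?D. 1 + symp_sign n v u) = ?d * ?d - 4"
  proof -
    have "(\<Sum>u\<in>pvecs n. 1 + symp_sign n v u) = ?d * ?d"
      using v by (simp add: sum.distrib sum_symp_sign card_pvecs)
    then show ?thesis using v by (simp add: sum_diff1)
  qed
  finally have "2 * (\<Sum>u\<in>?D. joint_diag n v u) = (?d * ?d - 4) * joint_diag n v w" .
  moreover have "(\<Sum>u\<in>?D. joint_diag n v u) = (?d - 2) * joint_diag n v v"
    using sum_joint_diag_right[of n v] v by (simp add: sum_diff1 algebra_simps)
  ultimately have *: "(?d - 2) * (2 * joint_diag n v v) = (?d - 2) * ((?d + 2) * joint_diag n v w)"
    by (simp add: algebra_simps)
  \<comment> \<open>The factor d - 2 can be cancelled: on one qubit only 0 and \<open>v\<close>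
    commute with \<open>v\<close>, so a further commuting \<open>w\<close> would raise the total 4
    to at least 6.\<close>
  have "?d \<noteq> 2"
  proof
    assume d2: "?d = 2"
    have "(\<Sum>u\<in>pvecs n. 1 + symp_sign n v u) = 4"
      using v d2 by (simp add: sum.distrib sum_symp_sign card_pvecs)
    moreover have "(\<Sum>u\<in>{pzero, v, w}. 1 + symp_sign n v u) \<le> (\<Sum>u\<in>pvecs n. 1 + symp_sign n v u)"
    proof (rule sum_mono2)
      show "0 \<le> 1 + symp_sign n v u" for u using symp_sign_cases[of n v u] by auto
    qed (use v w in auto)
    ultimately show False using v w vw by simp
  qed
  with * have **: "2 * joint_diag n v v = (?d + 2) * joint_diag n v w" by simp
  have "?d + 2 > 0" by (simp add: add_pos_pos)
  then have "?d + 2 \<noteq> 0" by linarith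
  then have "joint_diag n v w = 2 * joint_diag n v v / (?d + 2)" unfolding ** by simp
  then show ?thesis by (simp add: joint_diag_self[OF v])
qed

text \<open>One formula for the three orbits: the last factor is d + 2 for equal, 2 for distinct
  commuting and 0 for anticommuting vectors. Its three summands become the three terms of the second
  moment.\<close>

lemma joint_diag_eq:
  assumes v: "v \<in> pvecs n" "v \<noteq> pzero" and w: "w \<in> pvecs n" "w \<noteq> pzero"
  shows "joint_diag n v w = card (clifford n) / ((2 ^ n + 1) * (2 ^ n + 2)) * (of_bool (v = w) * 2 ^ n + 1 + symp_sign n v w)"
proof -
  have "(2::real) ^ n + 2 > 0" by (simp add: add_pos_pos)
  then have nz: "(2::real) ^ n + 2 \<noteq> 0" by linarith
  consider "v = w" | "v \<noteq> w" "symp_sign n v w = 1" | "v \<noteq> w" "symp_sign n v w = - 1"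
    using symp_sign_cases[of n v w] by blast
  then show ?thesis
  proof cases
    case 1
    have "card (clifford n) / ((2 ^ n + 1) * (2 ^ n + 2)) * ((2::real) ^ n + 2) = card (clifford n) / (2 ^ n + 1)"
      using mult_divide_mult_cancel_right[OF nz, of "card (clifford n)" "2 ^ n + 1"] by (simp only: times_divide_eq_left)
    moreover have "of_bool (v = w) * 2 ^ n + 1 + symp_sign n v w = 2 ^ n + 2" using 1 by simp
    ultimately show ?thesis using joint_diag_self[OF v] 1 by (simp only:)
  next
    case 2
    then show ?thesis using joint_diag_commuting[OF v w] by simp
  next
    case 3
    then show ?thesis using joint_diag_symp_sign[of n v w] by simp
  qed
qed

lemma second_moment:
  assumes f: "f pzero = 0"
  shows "(\<Sum>U\<in>clifford n. (\<Sum>v\<in>pvecs n. diag_ind n U v * f v)\<^sup>2)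
    = card (clifford n) / ((2 ^ n + 1) * (2 ^ n + 2)) *
      (2 ^ n * (\<Sum>v\<in>pvecs n. (f v)\<^sup>2) + (\<Sum>v\<in>pvecs n. f v)\<^sup>2 + (\<Sum>v\<in>pvecs n. \<Sum>w\<in>pvecs n. symp_sign n v w * f v * f w))"
proof -
  let ?c = "card (clifford n) / ((2 ^ n + 1) * (2 ^ n + 2)) :: real"
  have "(\<Sum>U\<in>clifford n. (\<Sum>v\<in>pvecs n. diag_ind n U v * f v)\<^sup>2) = (\<Sum>U\<in>clifford n. \<Sum>v\<in>pvecs n. \<Sum>w\<in>pvecs n. diag_ind n U v * diag_ind n U w * (f v * f w))"
    by (simp add: power2_eq_square sum_product mult_ac)
  also have "\<dots> = (\<Sum>v\<in>pvecs n. \<Sum>w\<in>pvecs n. joint_diag n v w * (f v * f w))"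
    unfolding joint_diag_def sum_distrib_right by (subst sum.swap, rule sum.cong[OF refl], rule sum.swap)
  also have "\<dots> = (\<Sum>v\<in>pvecs n. \<Sum>w\<in>pvecs n. ?c * ((if w = v then 2 ^ n * (f v)\<^sup>2 else 0) + f v * f w + symp_sign n v w * f v * f w))"
  proof (intro sum.cong refl)
    fix v w assume vw: "v \<in> pvecs n" "w \<in> pvecs n"
    show "joint_diag n v w * (f v * f w) = ?c * ((if w = v then 2 ^ n * (f v)\<^sup>2 else 0) + f v * f w + symp_sign n v w * f v * f w)"
    proof (cases "v = pzero \<or> w = pzero")
      case True
      then show ?thesis using f by auto
    next
      case False
      then have "joint_diag n v w = ?c * (of_bool (v = w) * 2 ^ n + 1 + symp_sign n v w)" using vw joint_diag_eq by auto
      then show ?thesis by (cases "v = w") (simp_all add: power2_eq_square algebra_simps)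
    qed
  qed
  also have "\<dots> = ?c * (2 ^ n * (\<Sum>v\<in>pvecs n. (f v)\<^sup>2) + (\<Sum>v\<in>pvecs n. f v)\<^sup>2 + (\<Sum>v\<in>pvecs n. \<Sum>w\<in>pvecs n. symp_sign n v w * f v * f w))"
  proof -
    have "(\<Sum>v\<in>pvecs n. f v)\<^sup>2 = (\<Sum>v\<in>pvecs n. \<Sum>w\<in>pvecs n. f v * f w)"
      by (simp only: power2_eq_square sum_product)
    moreover have "(\<Sum>v\<in>pvecs n. \<Sum>w\<in>pvecs n. if w = v then 2 ^ n * (f v)\<^sup>2 else 0) = 2 ^ n * (\<Sum>v\<in>pvecs n. (f v)\<^sup>2)"
      by (simp add: sum_distrib_left)
    ultimately show ?thesis unfolding sum_distrib_left[symmetric] sum.distrib by simp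
  qed
  finally show ?thesis .
qed

section \<open>Inverting the measurement channel\<close>

lemma pauli_coeff_pzero: "pauli_coeff n X pzero = tr (2 ^ n) X"
  by (simp add: pauli_coeff_def tr_def)

lemma sum_diag_ind_clifford:
  assumes "v \<in> pvecs n"
  shows "(\<Sum>U\<in>clifford n. diag_ind n U v) = card (clifford n) / (2 ^ n + 1) * (if v = pzero then 2 ^ n + 1 else 1)"
proof -
  have "0 < (2::real) ^ n + 1" by (simp add: add_pos_pos)
  then show ?thesis
    using joint_diag_self[of v n] assms by (auto simp: joint_diag_def diag_ind_pzero)
qed

text \<open>The identity is always diagonalised and every other Pauli operator by the fraction 1 /
  (d + 1) of the group, so the average is a depolarising channel.\<close>

lemma meas_channel_entry:
  assumes ij: "i < 2 ^ n" "j < 2 ^ n"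
  shows "meas_channel n X i j = (X i j + (if i = j then tr (2 ^ n) X else 0)) / (2 ^ n + 1)"
proof -
  \<comment> \<open>The matrix unit |i><j|: pairing the measured diagonals of \<open>X\<close> and
    \<open>E\<close> extracts the entry (i, j) of the channel.\<close>
  define E :: cmat where "E = (\<lambda>k l. if k = i \<and> l = j then 1 else 0)"
  define C where "C = complex_of_real (card (clifford n) / (2 ^ n + 1))"
  have cd: "cnj (U b i) * U b j = cnj (conj_diag (2 ^ n) U E b)" if "b < 2 ^ n" for U b
  proof -
    have "mmul (2 ^ n) U E b l = (if l = j then U b i else 0)" if "l < 2 ^ n" for l
    proof -
      have "mmul (2 ^ n) U E b l = (\<Sum>k<2 ^ n. if k = i then (if l = j then U b i else 0) else 0)"
        unfolding mmul_entry[OF \<open>b < 2 ^ n\<close> that] by (rule sum.cong) (auto simp: E_def)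
      then show ?thesis using ij by simp
    qed
    then have "conj_diag (2 ^ n) U E b = (\<Sum>l<2 ^ n. if l = j then U b i * cnj (U b j) else 0)"
      unfolding conj_diag_def mmul_entry[OF that that] by (intro sum.cong) (auto simp: dag_entry that)
    then show ?thesis using ij by simp
  qed
  have ftE: "pauli_coeff n E pzero = (if i = j then 1 else 0)"
  proof -
    have "pauli_coeff n E pzero = (\<Sum>l<2 ^ n. if l = i then (if i = j then 1 else 0) else 0)"
      unfolding pauli_coeff_def by (rule sum.cong) (auto simp: E_def)
    then show ?thesis using ij by simp
  qed
  have sumE: "(\<Sum>k<2 ^ n. \<Sum>l<2 ^ n. X k l * cnj (E k l)) = X i j"
  proof -
    have "(\<Sum>k<2 ^ n. \<Sum>l<2 ^ n. X k l * cnj (E k l)) = (\<Sum>k<2 ^ n. \<Sum>l<2 ^ n. if l = j then (if k = i then X i j else 0) else 0)"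
      by (intro sum.cong refl) (auto simp: E_def)
    then show ?thesis using ij by simp
  qed
  have "2 ^ n * (\<Sum>U\<in>clifford n. \<Sum>b<2 ^ n. conj_diag (2 ^ n) U X b * (cnj (U b i) * U b j))
      = (\<Sum>U\<in>clifford n. \<Sum>v\<in>pvecs n. of_real (diag_ind n U v) * (pauli_coeff n X v * cnj (pauli_coeff n E v)))"
    unfolding sum_distrib_left[of "2 ^ n"]
    by (intro sum.cong refl) (simp add: cd sum_conj_diag[symmetric] sum_distrib_left)
  also have "\<dots> = (\<Sum>v\<in>pvecs n. of_real (\<Sum>U\<in>clifford n. diag_ind n U v) * (pauli_coeff n X v * cnj (pauli_coeff n E v)))"
    by (subst sum.swap) (simp add: sum_distrib_right)
  also have "\<dots> = (\<Sum>v\<in>pvecs n. C * (pauli_coeff n X v * cnj (pauli_coeff n E v) + (if v = pzero then 2 ^ n * (pauli_coeff n X pzero * cnj (pauli_coeff n E pzero)) else 0)))"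
  proof (intro sum.cong refl)
    fix v assume v: "v \<in> pvecs n"
    have "complex_of_real (\<Sum>U\<in>clifford n. diag_ind n U v) = C * (if v = pzero then 2 ^ n + 1 else 1)"
      unfolding sum_diag_ind_clifford[OF v] of_real_mult C_def[symmetric] by simp
    then show "of_real (\<Sum>U\<in>clifford n. diag_ind n U v) * (pauli_coeff n X v * cnj (pauli_coeff n E v)) = C * (pauli_coeff n X v * cnj (pauli_coeff n E v) + (if v = pzero then 2 ^ n * (pauli_coeff n X pzero * cnj (pauli_coeff n E pzero)) else 0))"
      by (auto simp: algebra_simps)
  qed
  also have "\<dots> = C * ((\<Sum>v\<in>pvecs n. pauli_coeff n X v * cnj (pauli_coeff n E v)) + 2 ^ n * (pauli_coeff n X pzero * cnj (pauli_coeff n E pzero)))"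
    unfolding sum_distrib_left[symmetric] sum.distrib by simp
  also have "\<dots> = 2 ^ n * (C * (X i j + (if i = j then tr (2 ^ n) X else 0)))"
    unfolding pauli_coeff_parseval sumE ftE pauli_coeff_pzero[of n X] by (simp add: algebra_simps)
  finally have "(\<Sum>U\<in>clifford n. \<Sum>b<2 ^ n. conj_diag (2 ^ n) U X b * (cnj (U b i) * U b j))
     = C * (X i j + (if i = j then tr (2 ^ n) X else 0))" by simp
  then show ?thesis
    using card_clifford_pos[of n] ij by (simp add: meas_channel_def C_def)
qed

lemma complex_two_power_nz: "(2::complex) ^ n + 1 \<noteq> 0"
proof -
  have "(2::complex) ^ n + 1 = of_nat (2 ^ n + 1)" by simp
  also have "\<dots> \<noteq> 0" by (simp only: of_nat_eq_0_iff)
  finally show ?thesis .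
qed

lemma meas_inv_eq:
  assumes O: "supp_mat (2 ^ n) Ob" "tr (2 ^ n) Ob = 0"
  shows "meas_inv n Ob = msmult (2 ^ n) (2 ^ n + 1) Ob"
  unfolding meas_inv_def
proof (rule the_equality)
  have supp: "supp_mat (2 ^ n) (meas_channel n X)" for X by (simp add: supp_mat_def meas_channel_def)
  note nz = complex_two_power_nz[of n]
  show "supp_mat (2 ^ n) (msmult (2 ^ n) (2 ^ n + 1) Ob) \<and> meas_channel n (msmult (2 ^ n) (2 ^ n + 1) Ob) = Ob"
    by (intro conjI supp_ops supp_mat_eqI[OF supp O(1)]) (simp add: meas_channel_entry tr_msmult O msmult_entry nz)
  fix X assume X: "supp_mat (2 ^ n) X \<and> meas_channel n X = Ob"
  have entry: "(2 ^ n + 1) * Ob i j = X i j + (if i = j then tr (2 ^ n) X else 0)" if "i < 2 ^ n" "j < 2 ^ n" for i j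
    using meas_channel_entry[OF that, of X] X nz by simp
  \<comment> \<open>Uniqueness: the trace of the channel equation shows that a preimage of a
    traceless matrix is traceless, after which each entry is determined.\<close>
  have "(2 ^ n + 1) * tr (2 ^ n) Ob = (\<Sum>i<2 ^ n. X i i + tr (2 ^ n) X)"
    unfolding tr_def[of _ Ob] sum_distrib_left by (rule sum.cong) (simp_all add: entry)
  then have "(2 ^ n + 1) * tr (2 ^ n) X = 0"
    by (simp add: O sum.distrib tr_def[symmetric] algebra_simps)
  then have "tr (2 ^ n) X = 0" using nz by simp
  then show "X = msmult (2 ^ n) (2 ^ n + 1) Ob"
    using X entry by (intro supp_mat_eqI[of "2 ^ n"]) (auto simp: msmult_entry)
qed

section \<open>Hermitian operators and the variance formula\<close>

definition hermitian :: "cmat \<Rightarrow> bool" where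
  "hermitian A \<longleftrightarrow> (\<forall>i j. A i j = cnj (A j i))"

lemma cnj_hermitian: "hermitian A \<Longrightarrow> cnj (A i j) = A j i"
  unfolding hermitian_def by (metis complex_cnj_cnj)

lemma dag_hermitian: "supp_mat d A \<Longrightarrow> hermitian A \<Longrightarrow> dag d A = A"
  by (rule supp_mat_eqI[of d]) (auto simp: dag_entry cnj_hermitian)

lemma dag_dag: "supp_mat d A \<Longrightarrow> dag d (dag d A) = A"
  by (rule supp_mat_eqI[of d]) (auto simp: dag_entry)

lemma conj_diag_hermitian:
  assumes "supp_mat d A" "hermitian A" "supp_mat d U" "b < d"
  shows "cnj (conj_diag d U A b) = conj_diag d U A b"
proof -
  have "dag d (mmul d (mmul d U A) (dag d U)) = mmul d (mmul d U A) (dag d U)"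
    using assms by (simp add: dag_mmul dag_dag dag_hermitian mmul_assoc)
  then show ?thesis using dag_entry[OF assms(4,4), of "mmul d (mmul d U A) (dag d U)"]
    by (simp add: conj_diag_def)
qed

text \<open>The adjoint of X^a Z^b is (-1)^(a . b) X^a Z^b. The sign is the same for all Hermitian
  operators, so the product of one coefficient with the conjugate of another is real.\<close>

lemma cnj_pauli_coeff_hermitian:
  assumes "hermitian A" "v \<in> pvecs n"
  shows "cnj (pauli_coeff n A v) = of_real (chi n (snd v) (fst v)) * pauli_coeff n A v"
proof -
  have a: "fst v < 2 ^ n" using assms by (auto simp: pvecs_def)
  have "cnj (pauli_coeff n A v) = (\<Sum>l<2 ^ n. of_real (chi n (snd v) l) * A (l XOR fst v) l)"
    using assms(1) by (simp add: pauli_coeff_def cnj_hermitian)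
  also have "\<dots> = (\<Sum>l<2 ^ n. of_real (chi n (snd v) (l XOR fst v)) * A ((l XOR fst v) XOR fst v) (l XOR fst v))"
    by (rule sum_xor_reindex[OF a, symmetric])
  also have "\<dots> = of_real (chi n (snd v) (fst v)) * pauli_coeff n A v"
    unfolding pauli_coeff_def sum_distrib_left by (rule sum.cong) (simp_all add: chi_xor_right mult_ac)
  finally show ?thesis .
qed

lemma pauli_coeff_prod_real:
  assumes "hermitian A" "hermitian B" "v \<in> pvecs n"
  shows "pauli_coeff n A v * cnj (pauli_coeff n B v) = of_real (Re (pauli_coeff n A v * cnj (pauli_coeff n B v)))"
proof -
  have "cnj (pauli_coeff n A v * cnj (pauli_coeff n B v)) = of_real (chi n (snd v) (fst v) * chi n (snd v) (fst v)) * (pauli_coeff n A v * cnj (pauli_coeff n B v))"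
    using cnj_pauli_coeff_hermitian[OF assms(1,3)] cnj_pauli_coeff_hermitian[OF assms(2,3)]
    by (metis (no_types, lifting) complex_cnj_cnj complex_cnj_mult mult.assoc mult.commute mult.left_commute of_real_mult chi_sq of_real_1 mult_1 )
  then have "cnj (pauli_coeff n A v * cnj (pauli_coeff n B v)) = pauli_coeff n A v * cnj (pauli_coeff n B v)" by simp
  then show ?thesis by (metis Reals_cnj_iff of_real_Re)
qed

lemma Re_of_real_mult: "Re (complex_of_real r * z) = r * Re z"
  by simp

text \<open>The factor (d + 1) / d comes from the inverse channel and Parseval, and
  \<open>d * t\<close> is the sum of f. The t^2 contributions, (d + 1) / (d + 2) and -1, leave -1 /
  (d + 2).\<close>

lemma var_algebra:
  fixes d F G t :: real
  assumes "d > 0"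
  shows "((d + 1) / d)\<^sup>2 * (1 / ((d + 1) * (d + 2)) * (d * F + (d * t)\<^sup>2 + G)) - t\<^sup>2
    = (d + 1) / (d * (d + 2)) * (F + G / d) - t\<^sup>2 / (d + 2)"
proof -
  have "d + 1 \<noteq> 0" "d + 2 \<noteq> 0" "d \<noteq> 0" using assms by auto
  then show ?thesis by (simp add: divide_simps power2_eq_square, simp add: algebra_simps)
qed

lemma Vshadow_eq:
  fixes Ob \<rho> n
  defines "f \<equiv> \<lambda>v. Re (pauli_coeff n \<rho> v * cnj (pauli_coeff n Ob v))"
  assumes O: "supp_mat (2 ^ n) Ob" "hermitian Ob" "tr (2 ^ n) Ob = 0"
    and R: "supp_mat (2 ^ n) \<rho>" "hermitian \<rho>"
  shows "Vshadow n Ob \<rho> = (2 ^ n + 1) / (2 ^ n * (2 ^ n + 2)) *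
      ((\<Sum>v\<in>pvecs n. (f v)\<^sup>2) + (\<Sum>v\<in>pvecs n. \<Sum>w\<in>pvecs n. symp_sign n v w * f v * f w) / 2 ^ n)
      - (Re (tr (2 ^ n) (mmul (2 ^ n) Ob \<rho>)))\<^sup>2 / (2 ^ n + 2)"
proof -
  let ?d = "(2::real) ^ n"
  define t where "t = Re (tr (2 ^ n) (mmul (2 ^ n) Ob \<rho>))"
  define F2 where "F2 = (\<Sum>v\<in>pvecs n. (f v)\<^sup>2)"
  define G where "G = (\<Sum>v\<in>pvecs n. \<Sum>w\<in>pvecs n. symp_sign n v w * f v * f w)"
  have fr: "pauli_coeff n \<rho> v * cnj (pauli_coeff n Ob v) = of_real (f v)" if "v \<in> pvecs n" for v
    unfolding f_def by (rule pauli_coeff_prod_real[OF R(2) O(2) that])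
  \<comment> \<open>The trace of \<open>Ob\<close> being 0 enters here; the second moment formula
    requires it, since the identity is diagonalised by every \<open>U\<close>.\<close>
  have f0: "f pzero = 0" by (simp add: f_def pauli_coeff_pzero O)
  have sum_f: "(\<Sum>v\<in>pvecs n. f v) = ?d * t"
  proof -
    have "complex_of_real (\<Sum>v\<in>pvecs n. f v) = (\<Sum>v\<in>pvecs n. pauli_coeff n \<rho> v * cnj (pauli_coeff n Ob v))"
      by (simp add: fr)
    also have "\<dots> = 2 ^ n * (\<Sum>i<2 ^ n. \<Sum>j<2 ^ n. \<rho> i j * cnj (Ob i j))" by (rule pauli_coeff_parseval)
    also have "(\<Sum>i<2 ^ n. \<Sum>j<2 ^ n. \<rho> i j * cnj (Ob i j)) = (\<Sum>i<2 ^ n. \<Sum>j<2 ^ n. \<rho> i j * Ob j i)"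
      by (simp only: cnj_hermitian[OF O(2)])
    also have "\<dots> = tr (2 ^ n) (mmul (2 ^ n) \<rho> Ob)" by (simp add: tr_def mmul_entry)
    also have "\<dots> = tr (2 ^ n) (mmul (2 ^ n) Ob \<rho>)" by (rule tr_mmul_commute)
    finally have "Re (complex_of_real (\<Sum>v\<in>pvecs n. f v)) = Re (of_real (2 ^ n) * tr (2 ^ n) (mmul (2 ^ n) Ob \<rho>))"
      by simp
    then show ?thesis by (simp only: Re_complex_of_real t_def Re_of_real_mult)
  qed
  have shot: "Re (\<Sum>b<2 ^ n. conj_diag (2 ^ n) U \<rho> b * conj_diag (2 ^ n) U (meas_inv n Ob) b)
     = (?d + 1) / ?d * (\<Sum>v\<in>pvecs n. diag_ind n U v * f v)" if U: "U \<in> clifford n" for U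
  proof -
    have "conj_diag (2 ^ n) U (meas_inv n Ob) b = (2 ^ n + 1) * cnj (conj_diag (2 ^ n) U Ob b)" if "b < 2 ^ n" for b
      using that unfolding conj_diag_hermitian[OF O(1,2) supp_clifford[OF U] that]
      by (simp add: meas_inv_eq[OF O(1,3)] conj_diag_def mmul_msmult_left mmul_msmult_right msmult_entry)
    then have "2 ^ n * (\<Sum>b<2 ^ n. conj_diag (2 ^ n) U \<rho> b * conj_diag (2 ^ n) U (meas_inv n Ob) b)
      = (2 ^ n + 1) * (2 ^ n * (\<Sum>b<2 ^ n. conj_diag (2 ^ n) U \<rho> b * cnj (conj_diag (2 ^ n) U Ob b)))"
      unfolding sum_distrib_left by (intro sum.cong) auto
    also have "\<dots> = (2 ^ n + 1) * (\<Sum>v\<in>pvecs n. of_real (diag_ind n U v) * (pauli_coeff n \<rho> v * cnj (pauli_coeff n Ob v)))"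
      by (simp only: sum_conj_diag[OF U])
    also have "\<dots> = of_real ((?d + 1) * (\<Sum>v\<in>pvecs n. diag_ind n U v * f v))"
      by (simp add: fr)
    finally have "Re (of_real ?d * (\<Sum>b<2 ^ n. conj_diag (2 ^ n) U \<rho> b * conj_diag (2 ^ n) U (meas_inv n Ob) b)) = (?d + 1) * (\<Sum>v\<in>pvecs n. diag_ind n U v * f v)"
      by (metis Re_complex_of_real of_real_numeral of_real_power)
    then show ?thesis unfolding Re_of_real_mult by (simp add: field_simps)
  qed
  have "(\<Sum>U\<in>clifford n. (Re (\<Sum>b<2 ^ n. conj_diag (2 ^ n) U \<rho> b * conj_diag (2 ^ n) U (meas_inv n Ob) b))\<^sup>2)
    = ((?d + 1) / ?d)\<^sup>2 * (\<Sum>U\<in>clifford n. (\<Sum>v\<in>pvecs n. diag_ind n U v * f v)\<^sup>2)"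
    unfolding sum_distrib_left by (intro sum.cong refl) (simp only: shot power_mult_distrib)
  then have "Vshadow n Ob \<rho> = ((?d + 1) / ?d)\<^sup>2 * (1 / ((?d + 1) * (?d + 2)) * (?d * F2 + (?d * t)\<^sup>2 + G)) - t\<^sup>2"
    using card_clifford_pos[of n]
    by (simp add: Vshadow_def cl_avg_def second_moment[of f, OF f0] sum_f F2_def G_def t_def)
  also have "\<dots> = (?d + 1) / (?d * (?d + 2)) * (F2 + G / ?d) - t\<^sup>2 / (?d + 2)"
    by (rule var_algebra) simp
  finally show ?thesis by (simp add: F2_def G_def t_def)
qed

section \<open>Quadratic form bounds\<close>

lemma symp_sign_form_le:
  "(\<Sum>v\<in>pvecs n. \<Sum>w\<in>pvecs n. symp_sign n v w * f v * f w) \<le> 2 ^ n * (\<Sum>v\<in>pvecs n. (f v)\<^sup>2)"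
proof -
  let ?d = "(2::real) ^ n"
  define s where "s v = (\<Sum>w\<in>pvecs n. symp_sign n v w * f w)" for v
  have "(\<Sum>v\<in>pvecs n. (s v)\<^sup>2) = (\<Sum>v\<in>pvecs n. \<Sum>w\<in>pvecs n. \<Sum>u\<in>pvecs n. f w * f u * (symp_sign n w v * symp_sign n u v))"
    unfolding s_def power2_eq_square sum_product by (intro sum.cong refl) (simp add: symp_sign_commute mult_ac)
  also have "\<dots> = (\<Sum>w\<in>pvecs n. \<Sum>u\<in>pvecs n. \<Sum>v\<in>pvecs n. f w * f u * (symp_sign n w v * symp_sign n u v))"
    by (subst sum.swap, rule sum.cong[OF refl], rule sum.swap)
  also have "\<dots> = (\<Sum>w\<in>pvecs n. \<Sum>u\<in>pvecs n. if u = w then ?d * ?d * (f w)\<^sup>2 else 0)"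
    unfolding sum_distrib_left[symmetric] by (intro sum.cong refl) (simp add: sum_symp_sign_symp_sign power2_eq_square)
  also have "\<dots> = ?d * ?d * (\<Sum>v\<in>pvecs n. (f v)\<^sup>2)"
    by (simp add: sum_distrib_left)
  finally have s2: "(\<Sum>v\<in>pvecs n. (s v)\<^sup>2) = ?d * ?d * (\<Sum>v\<in>pvecs n. (f v)\<^sup>2)" .
  have fs: "(\<Sum>v\<in>pvecs n. \<Sum>w\<in>pvecs n. symp_sign n v w * f v * f w) = (\<Sum>v\<in>pvecs n. f v * s v)"
    unfolding s_def sum_distrib_left by (intro sum.cong refl) simp
  have "0 \<le> (\<Sum>v\<in>pvecs n. (?d * f v - s v)\<^sup>2)" by (rule sum_nonneg) simp
  also have "\<dots> = (\<Sum>v\<in>pvecs n. ?d * ?d * (f v)\<^sup>2 + (s v)\<^sup>2 - 2 * ?d * (f v * s v))"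
    by (rule sum.cong) (simp_all add: power2_eq_square algebra_simps)
  also have "\<dots> = 2 * ?d * (?d * (\<Sum>v\<in>pvecs n. (f v)\<^sup>2) - (\<Sum>v\<in>pvecs n. f v * s v))"
    unfolding sum_subtractf sum.distrib s2 sum_distrib_left[symmetric] by (simp add: algebra_simps)
  finally have "0 \<le> 2 * ?d * (?d * (\<Sum>v\<in>pvecs n. (f v)\<^sup>2) - (\<Sum>v\<in>pvecs n. f v * s v))" .
  moreover have "0 < 2 * ?d" by simp
  ultimately show ?thesis unfolding fs zero_le_mult_iff by linarith
qed

lemma cmod_sq: "(complex_of_real (cmod z))\<^sup>2 = z * cnj z"
  by (simp only: complex_norm_square of_real_power[symmetric])

lemma of_real_chi_sq [simp]: "complex_of_real (chi n a b) * complex_of_real (chi n a b) = 1"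
  by (simp only: of_real_mult[symmetric] chi_sq of_real_1)

lemma pauli_coeff_proj: 
  assumes "v \<in> pvecs n"
  shows "pauli_coeff n (proj n \<phi>) v = (\<Sum>l<2 ^ n. of_real (chi n (snd v) l) * (\<phi> l * cnj (\<phi> (l XOR fst v))))"
  unfolding pauli_coeff_def by (rule sum.cong) (use assms in \<open>auto simp: proj_def pvecs_def\<close>)

lemma sum_symp_sign_pure:
  assumes v: "v \<in> pvecs n"
  shows "(\<Sum>w\<in>pvecs n. symp_sign n v w * (cmod (pauli_coeff n (proj n \<phi>) w))\<^sup>2) = 2 ^ n * (cmod (pauli_coeff n (proj n \<phi>) v))\<^sup>2"
proof -
  obtain a b where ab: "v = (a, b)" "a < 2 ^ n" "b < 2 ^ n" using v by (auto simp: pvecs_def)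
  define D where "D l = of_real (chi n b l) * (\<phi> l * cnj (\<phi> (l XOR a)))" for l
  have row: "(\<Sum>z<2 ^ n. of_real (chi n a z) * (pauli_coeff n (proj n \<phi>) (c, z) * cnj (pauli_coeff n (proj n \<phi>) (c, z))))
     = 2 ^ n * (\<Sum>l<2 ^ n. (\<phi> (l XOR a) * cnj (\<phi> ((l XOR a) XOR c))) * (cnj (\<phi> l) * \<phi> (l XOR c)))" if c: "c < 2 ^ n" for c
  proof -
    have "of_real (chi n a z) * pauli_coeff n (proj n \<phi>) (c, z) = (\<Sum>l<2 ^ n. of_real (chi n z l) * (\<phi> (l XOR a) * cnj (\<phi> ((l XOR a) XOR c))))"
      if z: "z < 2 ^ n" for z
    proof -
      have "(c, z) \<in> pvecs n" using c z by (simp add: pvecs_def)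
      then have "of_real (chi n a z) * pauli_coeff n (proj n \<phi>) (c, z) = (\<Sum>l<2 ^ n. of_real (chi n z (l XOR a)) * (\<phi> l * cnj (\<phi> (l XOR c))))"
        by (simp add: pauli_coeff_proj sum_distrib_left chi_xor_right chi_commute[of n a z] mult_ac)
      also have "\<dots> = (\<Sum>l<2 ^ n. of_real (chi n z ((l XOR a) XOR a)) * (\<phi> (l XOR a) * cnj (\<phi> ((l XOR a) XOR c))))"
        by (rule sum_xor_reindex[OF ab(2), symmetric])
      finally show ?thesis by simp
    qed
    moreover have "cnj (pauli_coeff n (proj n \<phi>) (c, z)) = (\<Sum>l<2 ^ n. of_real (chi n z l) * (cnj (\<phi> l) * \<phi> (l XOR c)))" 
      if "z < 2 ^ n" for z
      using that c by (simp add: pauli_coeff_proj pvecs_def)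
    ultimately have "(\<Sum>z<2 ^ n. of_real (chi n a z) * (pauli_coeff n (proj n \<phi>) (c, z) * cnj (pauli_coeff n (proj n \<phi>) (c, z))))
      = (\<Sum>z<2 ^ n. (\<Sum>l<2 ^ n. of_real (chi n z l) * (\<phi> (l XOR a) * cnj (\<phi> ((l XOR a) XOR c)))) * (\<Sum>l<2 ^ n. of_real (chi n z l) * (cnj (\<phi> l) * \<phi> (l XOR c))))"
      by (intro sum.cong refl) (simp add: mult.assoc[symmetric])
    also have "\<dots> = 2 ^ n * (\<Sum>l<2 ^ n. (\<phi> (l XOR a) * cnj (\<phi> ((l XOR a) XOR c))) * (cnj (\<phi> l) * \<phi> (l XOR c)))"
      by (rule chi_parseval)
    finally show ?thesis .
  qed
  have "complex_of_real (\<Sum>w\<in>pvecs n. symp_sign n v w * (cmod (pauli_coeff n (proj n \<phi>) w))\<^sup>2)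
     = (\<Sum>c<2 ^ n. of_real (chi n b c) * (\<Sum>z<2 ^ n. of_real (chi n a z) * (pauli_coeff n (proj n \<phi>) (c, z) * cnj (pauli_coeff n (proj n \<phi>) (c, z)))))"
    unfolding sum_pvecs by (simp add: ab symp_sign_def cmod_sq sum_distrib_left mult_ac)
  also have "\<dots> = (\<Sum>c<2 ^ n. \<Sum>l<2 ^ n. 2 ^ n * of_real (chi n b c) * ((\<phi> (l XOR a) * cnj (\<phi> ((l XOR a) XOR c))) * (cnj (\<phi> l) * \<phi> (l XOR c))))"
    by (intro sum.cong refl) (simp add: row sum_distrib_left mult_ac)
  also have "\<dots> = (\<Sum>l<2 ^ n. \<Sum>c<2 ^ n. 2 ^ n * (cnj (D l) * D (l XOR c)))"
    by (subst sum.swap, intro sum.cong refl) (simp add: D_def chi_xor_right mult_ac xor.assoc xor.left_commute xor.commute)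
  also have "\<dots> = (\<Sum>l<2 ^ n. \<Sum>k<2 ^ n. 2 ^ n * (cnj (D l) * D k))"
    by (intro sum.cong refl sum_xor_reindex') simp
  also have "\<dots> = 2 ^ n * (cnj (\<Sum>l<2 ^ n. D l) * (\<Sum>k<2 ^ n. D k))"
    by (simp add: sum_distrib_left[symmetric] sum_distrib_right[symmetric])
  also have "(\<Sum>l<2 ^ n. D l) = pauli_coeff n (proj n \<phi>) v"
    using pauli_coeff_proj[OF v, of \<phi>] by (simp add: D_def ab)
  also have "2 ^ n * (cnj (pauli_coeff n (proj n \<phi>) v) * pauli_coeff n (proj n \<phi>) v) = complex_of_real (2 ^ n * (cmod (pauli_coeff n (proj n \<phi>) v))\<^sup>2)"
    by (simp only: of_real_mult complex_norm_square) (simp add: mult.commute)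
  finally show ?thesis by (simp only: of_real_eq_iff)
qed

lemma sum_two_points:
  fixes F :: "nat \<Rightarrow> 'a::comm_monoid_add"
  assumes "i < d" "j < d" "i \<noteq> j" "\<And>k. k \<noteq> i \<Longrightarrow> k \<noteq> j \<Longrightarrow> F k = 0"
  shows "(\<Sum>k<d. F k) = F i + F j"
proof -
  have "(\<Sum>k<d. F k) = (\<Sum>k\<in>{i, j}. F k)"
    by (rule sum.mono_neutral_right) (use assms in auto)
  then show ?thesis using assms(3) by simp
qed

lemma density_diag:
  assumes "density n \<rho>" "i < 2 ^ n"
  shows "Re (\<rho> i i) \<ge> 0" "\<rho> i i = of_real (Re (\<rho> i i))"
proof -
  have "0 \<le> Re (\<Sum>k<2 ^ n. \<Sum>l<2 ^ n. cnj (v k) * \<rho> k l * v l)" for v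
    using assms(1) unfolding density_def by blast
  from this[of "\<lambda>k. of_bool (k = i)"]
  have "0 \<le> Re (\<Sum>k<2 ^ n. \<Sum>l<2 ^ n. cnj ((\<lambda>k. of_bool (k = i)) k) * \<rho> k l * (\<lambda>k. of_bool (k = i)) l)" .
  also have "(\<Sum>k<2 ^ n. \<Sum>l<2 ^ n. cnj ((\<lambda>k. of_bool (k = i)) k) * \<rho> k l * (\<lambda>k. of_bool (k = i)) l)
     = (\<Sum>k<2 ^ n. \<Sum>l<2 ^ n. if l = i then (if k = i then \<rho> i i else 0) else 0)"
    by (intro sum.cong refl) auto
  also have "\<dots> = \<rho> i i" using assms(2) by simp
  finally show "Re (\<rho> i i) \<ge> 0" .
  have "cnj (\<rho> i i) = \<rho> i i" using assms(1) unfolding density_def by metis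
  then show "\<rho> i i = of_real (Re (\<rho> i i))" by (metis Reals_cnj_iff of_real_Re)
qed

lemma density_entry_le:
  assumes R: "density n \<rho>" and ij: "i < 2 ^ n" "j < 2 ^ n"
  shows "(cmod (\<rho> i j))\<^sup>2 \<le> Re (\<rho> i i) * Re (\<rho> j j)"
proof (cases "i = j")
  case True
  show ?thesis unfolding True by (subst density_diag(2)[OF R ij(2)]) (simp add: power2_eq_square)
next
  case ne: False
  define a where "a = Re (\<rho> i i)"
  define b where "b = Re (\<rho> j j)"
  define c where "c = (cmod (\<rho> i j))\<^sup>2"
  have ab: "\<rho> i i = of_real a" "\<rho> j j = of_real b" "a \<ge> 0" "b \<ge> 0"
    unfolding a_def b_def using density_diag[OF R ij(1)] density_diag[OF R ij(2)] by auto
  have c: "\<rho> i j * cnj (\<rho> i j) = of_real c" by (simp add: c_def cmod_sq)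
  have ji: "\<rho> j i = cnj (\<rho> i j)" using R unfolding density_def by metis
  have q: "s\<^sup>2 * a + t\<^sup>2 * c * b - 2 * s * t * c \<ge> 0" for s t :: real
  proof -
    define v where "v k = (if k = i then of_real s else if k = j then - (of_real t * cnj (\<rho> i j)) else 0)" for k :: nat
    have "(\<Sum>k<2 ^ n. \<Sum>l<2 ^ n. cnj (v k) * \<rho> k l * v l) = (\<Sum>k<2 ^ n. cnj (v k) * \<rho> k i * v i + cnj (v k) * \<rho> k j * v j)"
      by (intro sum.cong refl sum_two_points ij ne) (simp add: v_def)
    also have "\<dots> = (cnj (v i) * \<rho> i i * v i + cnj (v i) * \<rho> i j * v j) + (cnj (v j) * \<rho> j i * v i + cnj (v j) * \<rho> j j * v j)"
      by (intro sum_two_points ij ne) (simp add: v_def)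
    also have "\<dots> = of_real (s\<^sup>2 * a) - 2 * of_real (s * t) * (\<rho> i j * cnj (\<rho> i j)) + of_real (t\<^sup>2 * b) * (\<rho> i j * cnj (\<rho> i j))"
      using ne by (simp add: v_def ab ji power2_eq_square algebra_simps)
    also have "\<dots> = of_real (s\<^sup>2 * a + t\<^sup>2 * c * b - 2 * s * t * c)"
      unfolding c by (simp add: algebra_simps)
    finally have "(\<Sum>k<2 ^ n. \<Sum>l<2 ^ n. cnj (v k) * \<rho> k l * v l) = of_real (s\<^sup>2 * a + t\<^sup>2 * c * b - 2 * s * t * c)" .
    moreover have "0 \<le> Re (\<Sum>k<2 ^ n. \<Sum>l<2 ^ n. cnj (v k) * \<rho> k l * v l)"
      using R unfolding density_def by blast
    ultimately show ?thesis by simp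
  qed
  have "c \<ge> 0" by (simp add: c_def)
  have "c \<le> a * b"
  proof (cases "b = 0")
    case True
    have "c = 0"
    proof (rule ccontr)
      assume "c \<noteq> 0"
      then have "2 * ((a + 1) / c) * c = 2 * (a + 1)" by simp
      then show False using q[of 1 "(a + 1) / c"] True ab(3) by simp
    qed
    then show ?thesis using ab by simp
  next
    case False
    then have b: "b > 0" using ab by simp
    have "0 \<le> b * (a * b - c)" using q[of b 1] by (simp add: power2_eq_square algebra_simps)
    then show ?thesis using b by (simp add: zero_le_mult_iff)
  qed
  then show ?thesis by (simp add: a_def b_def c_def)
qed

lemma density_trace:
  assumes "density n \<rho>"
  shows "(\<Sum>i<2 ^ n. Re (\<rho> i i)) = 1"
proof -
  have "Re (tr (2 ^ n) \<rho>) = 1" using assms by (simp add: density_def)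
  then show ?thesis by (simp add: tr_def)
qed

lemma cmod_pauli_coeff_density_le_1:
  assumes R: "density n \<rho>" and v: "v \<in> pvecs n"
  shows "cmod (pauli_coeff n \<rho> v) \<le> 1"
proof -
  have a: "fst v < 2 ^ n" using v by (auto simp: pvecs_def)
  have "cmod (pauli_coeff n \<rho> v) \<le> (\<Sum>l<2 ^ n. cmod (of_real (chi n (snd v) l) * \<rho> l (l XOR fst v)))"
    unfolding pauli_coeff_def by (rule norm_sum)
  also have "\<dots> \<le> (\<Sum>l<2 ^ n. (Re (\<rho> l l) + Re (\<rho> (l XOR fst v) (l XOR fst v))) / 2)"
  proof (rule sum_mono)
    fix l assume "l \<in> {..<(2::nat) ^ n}"
    then have l: "l < 2 ^ n" "l XOR fst v < 2 ^ n" using a by auto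
    let ?x = "Re (\<rho> l l)" and ?y = "Re (\<rho> (l XOR fst v) (l XOR fst v))"
    have xy: "?x \<ge> 0" "?y \<ge> 0" using density_diag[OF R] l by auto
    have "(cmod (\<rho> l (l XOR fst v)))\<^sup>2 \<le> ?x * ?y" by (rule density_entry_le[OF R l])
    also have "\<dots> \<le> ((?x + ?y) / 2)\<^sup>2"
      using zero_le_power2[of "?x - ?y"] by (simp add: power2_eq_square algebra_simps)
    finally have "cmod (\<rho> l (l XOR fst v)) \<le> (?x + ?y) / 2"
      by (rule power2_le_imp_le) (use xy in simp)
    moreover have "\<bar>chi n (snd v) l\<bar> = 1" using chi_cases[of n "snd v" l] by auto
    ultimately show "cmod (of_real (chi n (snd v) l) * \<rho> l (l XOR fst v)) \<le> (?x + ?y) / 2"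
      by (simp add: norm_mult)
  qed
  also have "\<dots> = ((\<Sum>l<2 ^ n. Re (\<rho> l l)) + (\<Sum>l<2 ^ n. Re (\<rho> (l XOR fst v) (l XOR fst v)))) / 2"
    by (simp add: sum.distrib[symmetric] sum_divide_distrib)
  also have "(\<Sum>l<2 ^ n. Re (\<rho> (l XOR fst v) (l XOR fst v))) = (\<Sum>l<2 ^ n. Re (\<rho> l l))"
    by (rule sum_xor_reindex[OF a])
  finally show ?thesis by (simp add: density_trace[OF R])
qed

lemma sum_cmod_pauli_coeff_sq: "(\<Sum>v\<in>pvecs n. (cmod (pauli_coeff n X v))\<^sup>2) = 2 ^ n * (\<Sum>i<2 ^ n. \<Sum>j<2 ^ n. (cmod (X i j))\<^sup>2)"
proof -
  have "complex_of_real (\<Sum>v\<in>pvecs n. (cmod (pauli_coeff n X v))\<^sup>2) = of_real (2 ^ n * (\<Sum>i<2 ^ n. \<Sum>j<2 ^ n. (cmod (X i j))\<^sup>2))"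
    using pauli_coeff_parseval[of n X X] by (simp add: cmod_sq)
  then show ?thesis by (simp only: of_real_eq_iff)
qed

lemma sum_pauli_coeff_density_pow4:
  assumes R: "density n \<rho>"
  shows "(\<Sum>v\<in>pvecs n - {pzero}. (cmod (pauli_coeff n \<rho> v)) ^ 4) \<le> 2 ^ n - 1"
proof -
  have "(\<Sum>v\<in>pvecs n - {pzero}. (cmod (pauli_coeff n \<rho> v)) ^ 4) \<le> (\<Sum>v\<in>pvecs n - {pzero}. (cmod (pauli_coeff n \<rho> v))\<^sup>2)"
    by (rule sum_mono, rule power_decreasing) (use cmod_pauli_coeff_density_le_1[OF R] in auto)
  also have "\<dots> = (\<Sum>v\<in>pvecs n. (cmod (pauli_coeff n \<rho> v))\<^sup>2) - 1"
  proof -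
    have "tr (2 ^ n) \<rho> = 1" using R by (simp add: density_def)
    then show ?thesis by (simp add: sum_diff1 pauli_coeff_pzero)
  qed
  also have "(\<Sum>v\<in>pvecs n. (cmod (pauli_coeff n \<rho> v))\<^sup>2) \<le> 2 ^ n * (\<Sum>i<2 ^ n. \<Sum>j<2 ^ n. Re (\<rho> i i) * Re (\<rho> j j))"
    unfolding sum_cmod_pauli_coeff_sq by (intro mult_left_mono sum_mono density_entry_le[OF R]) auto
  also have "(\<Sum>i<2 ^ n. \<Sum>j<2 ^ n. Re (\<rho> i i) * Re (\<rho> j j)) = 1"
    by (simp add: sum_product[symmetric] density_trace[OF R])
  finally show ?thesis by simp
qed

section \<open>Pauli strings\<close>

definition pcode :: "bool \<Rightarrow> bool \<Rightarrow> nat" where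
  "pcode x z = (if x then (if z then 2 else 1) else (if z then 3 else 0))"

definition pstr :: "nat \<Rightarrow> pvec \<Rightarrow> nat list" where
  "pstr n v = map (\<lambda>k. pcode (bit (fst v) k) (bit (snd v) k)) [0..<n]"

lemma pcode_inject: "pcode x z = pcode x' z' \<longleftrightarrow> x = x' \<and> z = z'"
  by (auto simp: pcode_def)

lemma bij_betw_pstr: "bij_betw (pstr n) (pvecs n) (pauli_strings n)"
proof -
  have ps: "pauli_strings n = {ps. set ps \<subseteq> {..<4} \<and> length ps = n}" by (auto simp: pauli_strings_def)
  have "inj_on (pstr n) (pvecs n)"
  proof (rule inj_onI)
    fix v w assume vw: "v \<in> pvecs n" "w \<in> pvecs n" "pstr n v = pstr n w"
    have bits: "bit (fst v) k = bit (fst w) k \<and> bit (snd v) k = bit (snd w) k" if "k < n" for k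
      using arg_cong[OF vw(3), of "\<lambda>ps. ps ! k"] that by (simp add: pstr_def pcode_inject)
    have "fst v = fst w" by (rule eq_if_bits_below[of _ n]) (use vw bits in \<open>auto simp: pvecs_def\<close>)
    moreover have "snd v = snd w" by (rule eq_if_bits_below[of _ n]) (use vw bits in \<open>auto simp: pvecs_def\<close>)
    ultimately show "v = w" by (simp add: prod_eq_iff)
  qed
  moreover have "pstr n ` pvecs n = pauli_strings n"
  proof (rule card_subset_eq)
    show "finite (pauli_strings n)" unfolding ps by (rule finite_lists_length_eq) simp
    show "pstr n ` pvecs n \<subseteq> pauli_strings n"
      by (auto simp: pauli_strings_def pstr_def pcode_def)
    show "card (pstr n ` pvecs n) = card (pauli_strings n)"
      using card_image[OF \<open>inj_on (pstr n) (pvecs n)\<close>] card_lists_length_eq[of "{..<4::nat}" n]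
      by (simp add: ps card_pvecs power_mult_distrib[symmetric])
  qed
  ultimately show ?thesis by (simp add: bij_betw_def)
qed

lemma prod_if_zero:
  fixes s :: "nat \<Rightarrow> 'a::comm_semiring_1"
  shows "(\<Prod>k<n. if P k then s k else 0) = (if \<forall>k<n. P k then \<Prod>k<n. s k else 0)"
  by (induction n) (auto simp: less_Suc_eq)

lemma pauli_pstr:
  assumes v: "v \<in> pvecs n"
  obtains c where "cmod c = 1" "\<And>i j. pauli n (pstr n v) i j = c * weyl n v i j"
proof -
  define ph where "ph k = (if bit (fst v) k \<and> bit (snd v) k then \<i> else 1)" for k
  have p1: "pauli1 (pcode x z) (of_bool \<alpha>) (of_bool \<beta>) = (if x \<and> z then \<i> else 1) * (if \<alpha> = (\<beta> \<noteq> x) then (if z \<and> \<beta> then - 1 else 1) else 0)"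
    for x z \<alpha> \<beta> by (auto simp: pauli1_def pcode_def)
  have "pauli n (pstr n v) i j = (\<Prod>k<n. ph k) * weyl n v i j" for i j
  proof (cases "i < 2 ^ n \<and> j < 2 ^ n")
    case True
    then have less: "j XOR fst v < 2 ^ n" using v by (auto simp: pvecs_def)
    have "(\<forall>k<n. bit i k = (bit j k \<noteq> bit (fst v) k)) \<longleftrightarrow> (\<forall>k<n. bit i k = bit (j XOR fst v) k)"
      by (auto simp: bit_xor_iff)
    also have "\<dots> \<longleftrightarrow> i = j XOR fst v" using eq_if_bits_below[of i n "j XOR fst v"] True less by auto
    finally have eq: "(\<forall>k<n. bit i k = (bit j k \<noteq> bit (fst v) k)) \<longleftrightarrow> i = j XOR fst v" .
    have "pauli n (pstr n v) i j = (\<Prod>k<n. ph k * (if bit i k = (bit j k \<noteq> bit (fst v) k) then (if bit (snd v) k \<and> bit j k then - 1 else 1) else 0))"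
      using True unfolding pauli_def bitq_eq ph_def
      by (auto simp: pstr_def p1 simp del: of_bool_eq intro!: prod.cong)
    also have "\<dots> = (\<Prod>k<n. ph k) * (if i = j XOR fst v then (\<Prod>k<n. if bit (snd v) k \<and> bit j k then - 1 else 1) else 0)"
      unfolding prod.distrib prod_if_zero eq ..
    also have "(\<Prod>k<n. if bit (snd v) k \<and> bit j k then - 1 else 1) = complex_of_real (chi n (snd v) j)"
      unfolding chi_def of_real_prod by (rule prod.cong) auto
    finally show ?thesis using True by (simp add: weyl_def)
  qed (auto simp: pauli_def weyl_def)
  moreover have "cmod (\<Prod>k<n. ph k) = 1"
    unfolding prod_norm[symmetric] by (rule prod.neutral) (auto simp: ph_def)
  ultimately show ?thesis using that by blast
qed

lemma cnj_pauli: "cnj (pauli n ps i j) = pauli n ps j i"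
proof -
  have "cnj (pauli1 p a b) = pauli1 p b a" for p a b by (auto simp: pauli1_def)
  then show ?thesis by (auto simp: pauli_def)
qed

lemma Xi_sq:
  assumes v: "v \<in> pvecs n"
  shows "(Xi n \<phi> (pstr n v))\<^sup>2 = (cmod (pauli_coeff n (proj n \<phi>) v))\<^sup>2"
proof -
  define z where "z = (\<Sum>i<2 ^ n. \<Sum>j<2 ^ n. cnj (\<phi> i) * pauli n (pstr n v) i j * \<phi> j)"
  have "cnj z = (\<Sum>i<2 ^ n. \<Sum>j<2 ^ n. cnj (\<phi> j) * pauli n (pstr n v) j i * \<phi> i)"
    by (simp add: z_def cnj_pauli mult_ac)
  also have "\<dots> = z" unfolding z_def by (rule sum.swap)
  finally have "z = of_real (Re z)" by (metis Reals_cnj_iff of_real_Re)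
  then have "cmod z = \<bar>Re z\<bar>" by (metis norm_of_real)
  then have "(Xi n \<phi> (pstr n v))\<^sup>2 = (cmod z)\<^sup>2" by (simp add: Xi_def z_def)
  obtain c where c: "cmod c = 1" "\<And>i j. pauli n (pstr n v) i j = c * weyl n v i j"
    using pauli_pstr[OF v] by blast
  have "z = c * tr (2 ^ n) (mmul (2 ^ n) (weyl n v) (proj n \<phi>))"
    unfolding z_def tr_def sum_distrib_left
    by (intro sum.cong refl) (simp add: mmul_entry c proj_def sum_distrib_left mult_ac)
  then have "cmod z = cmod (pauli_coeff n (proj n \<phi>) v)" by (simp add: tr_mmul_weyl[OF v] norm_mult c)
  with \<open>(Xi n \<phi> (pstr n v))\<^sup>2 = (cmod z)\<^sup>2\<close> show ?thesis by simp
qed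

lemma sum_Xi_pow4: "(\<Sum>ps\<in>pauli_strings n. (Xi n \<phi> ps) ^ 4) = (\<Sum>v\<in>pvecs n. (cmod (pauli_coeff n (proj n \<phi>) v)) ^ 4)"
proof -
  have "(\<Sum>ps\<in>pauli_strings n. (Xi n \<phi> ps) ^ 4) = (\<Sum>v\<in>pvecs n. (Xi n \<phi> (pstr n v)) ^ 4)"
    by (rule sum.reindex_bij_betw[OF bij_betw_pstr, symmetric])
  also have "\<dots> = (\<Sum>v\<in>pvecs n. ((Xi n \<phi> (pstr n v))\<^sup>2)\<^sup>2)" by simp
  also have "\<dots> = (\<Sum>v\<in>pvecs n. (cmod (pauli_coeff n (proj n \<phi>) v)) ^ 4)"
    by (rule sum.cong) (simp_all only: Xi_sq, simp)
  finally show ?thesis .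
qed

section \<open>The shadow variance\<close>

lemma hermitian_proj: "hermitian (proj n \<phi>)"
  by (auto simp: hermitian_def proj_def)

lemma supp_proj [simp]: "supp_mat (2 ^ n) (proj n \<phi>)"
  by (auto simp: supp_mat_def proj_def)

lemma tr_proj: "unit_state n \<phi> \<Longrightarrow> tr (2 ^ n) (proj n \<phi>) = 1"
proof -
  assume u: "unit_state n \<phi>"
  have "tr (2 ^ n) (proj n \<phi>) = of_real (\<Sum>i<2 ^ n. (cmod (\<phi> i))\<^sup>2)"
    by (simp add: tr_def proj_def cmod_sq)
  then show ?thesis using u by (simp only: unit_state_def of_real_1)
qed

lemma density_proj:
  assumes "unit_state n \<phi>"
  shows "density n (proj n \<phi>)"
  unfolding density_def
proof (intro conjI allI)
  show "supp_mat (2 ^ n) (proj n \<phi>)" by simp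
  show "tr (2 ^ n) (proj n \<phi>) = 1" by (rule tr_proj[OF assms])
  show "proj n \<phi> i j = cnj (proj n \<phi> j i)" for i j by (auto simp: proj_def)
  fix v :: cvec
  define z where "z = (\<Sum>i<2 ^ n. cnj (v i) * \<phi> i)"
  have "(\<Sum>i<2 ^ n. \<Sum>j<2 ^ n. cnj (v i) * proj n \<phi> i j * v j) = z * cnj z"
    unfolding z_def cnj_sum sum_product by (intro sum.cong refl) (simp add: proj_def mult_ac)
  also have "\<dots> = of_real ((cmod z)\<^sup>2)" by (rule complex_norm_square[symmetric])
  finally show "0 \<le> Re (\<Sum>i<2 ^ n. \<Sum>j<2 ^ n. cnj (v i) * proj n \<phi> i j * v j)" by simp
qed

definition obs :: "nat \<Rightarrow> cvec \<Rightarrow> cmat" where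
  "obs n \<phi> = madd (2 ^ n) (proj n \<phi>) (msmult (2 ^ n) (- (1 / of_nat (2 ^ n))) (idm (2 ^ n)))"

lemma obs_entry:
  "i < 2 ^ n \<Longrightarrow> j < 2 ^ n \<Longrightarrow> obs n \<phi> i j = proj n \<phi> i j - (if i = j then 1 / 2 ^ n else 0)"
  by (auto simp: obs_def madd_def msmult_def idm_def)

lemma supp_obs: "supp_mat (2 ^ n) (obs n \<phi>)"
  by (simp add: obs_def)

lemma hermitian_obs: "hermitian (obs n \<phi>)"
  by (auto simp: hermitian_def obs_def madd_def msmult_def idm_def proj_def)

lemma tr_obs: "unit_state n \<phi> \<Longrightarrow> tr (2 ^ n) (obs n \<phi>) = 0"
  using tr_proj[of n \<phi>] by (simp add: tr_def obs_entry sum_subtractf)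

lemma pauli_coeff_obs:
  assumes v: "v \<in> pvecs n" and u: "unit_state n \<phi>"
  shows "pauli_coeff n (obs n \<phi>) v = (if v = pzero then 0 else pauli_coeff n (proj n \<phi>) v)"
proof (cases "v = pzero")
  case True
  then show ?thesis using tr_obs[OF u] by (simp add: pauli_coeff_pzero)
next
  case False
  obtain a b where ab: "v = (a, b)" "a < 2 ^ n" "b < 2 ^ n" using v by (auto simp: pvecs_def)
  have "a = l XOR (a XOR l)" for l by (simp add: xor.commute)
  then have la: "l = l XOR a \<longleftrightarrow> a = 0" for l by (metis xor.right_neutral xor_xor_cancel(2))
  have "pauli_coeff n (obs n \<phi>) v = (\<Sum>l<2 ^ n. of_real (chi n b l) * proj n \<phi> l (l XOR a) - (if a = 0 then of_real (chi n b l) / 2 ^ n else 0))"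
    unfolding pauli_coeff_def by (rule sum.cong) (use ab in \<open>auto simp: obs_entry la right_diff_distrib\<close>)
  also have "\<dots> = pauli_coeff n (proj n \<phi>) v - (if a = 0 then of_real (\<Sum>l<2 ^ n. chi n b l) / 2 ^ n else 0)"
    by (simp add: sum_subtractf pauli_coeff_def ab sum_divide_distrib)
  also have "\<dots> = pauli_coeff n (proj n \<phi>) v" using False ab by (auto simp: sum_chi)
  finally show ?thesis using False by simp
qed

definition pauli_sum4 :: "nat \<Rightarrow> cvec \<Rightarrow> real" where
  "pauli_sum4 n \<phi> = (\<Sum>v\<in>pvecs n. (cmod (pauli_coeff n (proj n \<phi>) v)) ^ 4)"

lemma pauli_sum4_minus_1:
  assumes "unit_state n \<phi>"
  shows "(\<Sum>v\<in>pvecs n - {pzero}. (cmod (pauli_coeff n (proj n \<phi>) v)) ^ 4) = pauli_sum4 n \<phi> - 1"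
  by (simp add: pauli_sum4_def sum_diff1 pauli_coeff_pzero tr_proj[OF assms])

lemma pauli_sum4_ge_1: "unit_state n \<phi> \<Longrightarrow> 1 \<le> pauli_sum4 n \<phi>"
  using pauli_sum4_minus_1[of n \<phi>] sum_nonneg[of "pvecs n - {pzero}" "\<lambda>v. (cmod (pauli_coeff n (proj n \<phi>) v)) ^ 4"] by simp

lemma powr_M2:
  assumes "unit_state n \<phi>"
  shows "2 powr (- M2 n \<phi>) = pauli_sum4 n \<phi> / 2 ^ n"
  using pauli_sum4_ge_1[OF assms] by (simp add: M2_def sum_Xi_pow4 pauli_sum4_def[symmetric])

lemma Vshadow_obs_pure:
  assumes u: "unit_state n \<phi>"
  shows "Vshadow n (obs n \<phi>) (proj n \<phi>) = (2 * (pauli_sum4 n \<phi> / 2 ^ n) * (2 ^ n + 1) - 4) / (2 ^ n + 2)"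
proof -
  let ?P = "proj n \<phi>" and ?d = "(2::real) ^ n"
  define S where "S = pauli_sum4 n \<phi>"
  define g where "g v = (cmod (pauli_coeff n ?P v))\<^sup>2" for v
  define f where "f v = Re (pauli_coeff n ?P v * cnj (pauli_coeff n (obs n \<phi>) v))" for v
  have f: "f v = g v - (if v = pzero then 1 else 0)" if "v \<in> pvecs n" for v
  proof -
    have "Re (pauli_coeff n ?P v * cnj (pauli_coeff n ?P v)) = g v" 
      by (simp only: g_def complex_norm_square[symmetric] Re_complex_of_real)
    then show ?thesis using pauli_coeff_obs[OF that u] by (auto simp: f_def g_def pauli_coeff_pzero tr_proj[OF u])
  qed
  have g0: "g pzero = 1" by (simp add: g_def pauli_coeff_pzero tr_proj[OF u])
  have sum_g: "(\<Sum>v\<in>pvecs n. g v) = ?d"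
    using sum_symp_sign_pure[of pzero n \<phi>] g0 by (simp add: g_def)
  have sum_g2: "(\<Sum>v\<in>pvecs n. (g v)\<^sup>2) = S" by (simp add: S_def pauli_sum4_def g_def)
  have F2: "(\<Sum>v\<in>pvecs n. (f v)\<^sup>2) = S - 1"
  proof -
    have "(\<Sum>v\<in>pvecs n. (f v)\<^sup>2) = (\<Sum>v\<in>pvecs n. (g v)\<^sup>2 - (if v = pzero then 1 else 0))"
      by (rule sum.cong) (auto simp: f g0)
    then show ?thesis by (simp add: sum_subtractf sum_g2)
  qed
  have symp_sign_f: "(\<Sum>w\<in>pvecs n. symp_sign n v w * f w) = ?d * g v - 1" if "v \<in> pvecs n" for v
  proof -
    have "(\<Sum>w\<in>pvecs n. symp_sign n v w * f w) = (\<Sum>w\<in>pvecs n. symp_sign n v w * g w - (if w = pzero then 1 else 0))"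
      by (rule sum.cong) (auto simp: f right_diff_distrib)
    then show ?thesis using sum_symp_sign_pure[OF that, of \<phi>] by (simp add: sum_subtractf g_def)
  qed
  have "(\<Sum>v\<in>pvecs n. \<Sum>w\<in>pvecs n. symp_sign n v w * f v * f w) = (\<Sum>v\<in>pvecs n. f v * (?d * g v - 1))"
  proof (rule sum.cong[OF refl])
    fix v assume v: "v \<in> pvecs n"
    show "(\<Sum>w\<in>pvecs n. symp_sign n v w * f v * f w) = f v * (?d * g v - 1)"
      unfolding symp_sign_f[OF v, symmetric] sum_distrib_left by (simp only: mult_ac)
  qed
  also have "\<dots> = (\<Sum>v\<in>pvecs n. ?d * (g v)\<^sup>2 - g v - (if v = pzero then ?d - 1 else 0))"
    by (intro sum.cong refl) (auto simp: f g0 power2_eq_square algebra_simps)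
  also have "\<dots> = ?d * S - ?d - (?d - 1)"
    by (simp add: sum_subtractf sum_distrib_left[symmetric] sum_g sum_g2)
  finally have G: "(\<Sum>v\<in>pvecs n. \<Sum>w\<in>pvecs n. symp_sign n v w * f v * f w) = ?d * S - 2 * ?d + 1" by simp
  have t: "tr (2 ^ n) (mmul (2 ^ n) (obs n \<phi>) ?P) = of_real (1 - 1 / ?d)"
  proof -
    have PP: "mmul (2 ^ n) ?P ?P = ?P"
    proof (rule supp_mat_eqI[of "2 ^ n"])
      fix i j :: nat assume ij: "i < 2 ^ n" "j < 2 ^ n"
      have "mmul (2 ^ n) ?P ?P i j = ?P i j * tr (2 ^ n) ?P"
        using ij by (simp add: mmul_entry tr_def sum_distrib_left proj_def mult_ac)
      then show "mmul (2 ^ n) ?P ?P i j = ?P i j" by (simp add: tr_proj[OF u])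
    qed simp_all
    have "mmul (2 ^ n) (obs n \<phi>) ?P i i = mmul (2 ^ n) ?P ?P i i - ?P i i / 2 ^ n" if "i < 2 ^ n" for i
    proof -
      have "mmul (2 ^ n) (obs n \<phi>) ?P i i = (\<Sum>k<2 ^ n. ?P i k * ?P k i - (if k = i then ?P i i / 2 ^ n else 0))"
        unfolding mmul_entry[OF that that] by (rule sum.cong) (auto simp: obs_entry that left_diff_distrib)
      then show ?thesis using that by (simp add: sum_subtractf mmul_entry)
    qed
    then have "tr (2 ^ n) (mmul (2 ^ n) (obs n \<phi>) ?P) = tr (2 ^ n) ?P - tr (2 ^ n) ?P / 2 ^ n"
      by (simp add: tr_def sum_subtractf PP sum_divide_distrib)
    then show ?thesis by (simp add: tr_proj[OF u])
  qed
  have "Vshadow n (obs n \<phi>) ?P = (?d + 1) / (?d * (?d + 2)) * ((S - 1) + (?d * S - 2 * ?d + 1) / ?d)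
      - (1 - 1 / ?d)\<^sup>2 / (?d + 2)"
    using Vshadow_eq[OF supp_obs hermitian_obs tr_obs[OF u] supp_proj[of n \<phi>] hermitian_proj[of n \<phi>]]
    unfolding f_def[symmetric] F2 G t Re_complex_of_real .
  also have "\<dots> = (2 * (S / ?d) * (?d + 1) - 4) / (?d + 2)"
  proof -
    have alg: "(d + 1) / (d * (d + 2)) * ((S - 1) + (d * S - 2 * d + 1) / d) - (1 - 1 / d)\<^sup>2 / (d + 2)
      = (2 * (S / d) * (d + 1) - 4) / (d + 2)" if "d > 0" for d :: real
    proof -
      have "d + 2 \<noteq> 0" "d \<noteq> 0" using that by auto
      then show ?thesis by (simp add: divide_simps power2_eq_square, simp add: algebra_simps)
    qed
    show ?thesis by (rule alg) simp
  qed
  finally show ?thesis by (simp add: S_def)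
qed

lemma Vshadow_obs_le:
  assumes u: "unit_state n \<phi>" and R: "density n \<rho>"
  shows "Vshadow n (obs n \<phi>) \<rho> \<le> 2 * (2 ^ n + 1) / (2 ^ n * (2 ^ n + 2)) * sqrt ((2 ^ n - 1) * (pauli_sum4 n \<phi> - 1))"
proof -
  let ?d = "(2::real) ^ n"
  define f where "f v = Re (pauli_coeff n \<rho> v * cnj (pauli_coeff n (obs n \<phi>) v))" for v
  define F where "F = (\<Sum>v\<in>pvecs n. (f v)\<^sup>2)"
  define G where "G = (\<Sum>v\<in>pvecs n. \<Sum>w\<in>pvecs n. symp_sign n v w * f v * f w)"
  have dpos: "?d > 0" "?d + 2 > 0" by (simp_all add: add_pos_pos)
  have "F = (\<Sum>v\<in>pvecs n - {pzero}. (f v)\<^sup>2)"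
    unfolding F_def by (simp add: sum_diff1 f_def pauli_coeff_pzero tr_obs[OF u])
  also have "\<dots> \<le> (\<Sum>v\<in>pvecs n - {pzero}. (cmod (pauli_coeff n \<rho> v))\<^sup>2 * (cmod (pauli_coeff n (proj n \<phi>) v))\<^sup>2)"
  proof (rule sum_mono)
    fix v assume v: "v \<in> pvecs n - {pzero}"
    have "\<bar>f v\<bar> \<le> cmod (pauli_coeff n \<rho> v * cnj (pauli_coeff n (proj n \<phi>) v))"
      unfolding f_def using pauli_coeff_obs[of v n \<phi>] u v by (simp only: if_False abs_Re_le_cmod Diff_iff singleton_iff)
    then have "\<bar>f v\<bar>\<^sup>2 \<le> (cmod (pauli_coeff n \<rho> v * cnj (pauli_coeff n (proj n \<phi>) v)))\<^sup>2" by (rule power_mono) simp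
    then show "(f v)\<^sup>2 \<le> (cmod (pauli_coeff n \<rho> v))\<^sup>2 * (cmod (pauli_coeff n (proj n \<phi>) v))\<^sup>2"
      by (simp add: norm_mult power_mult_distrib)
  qed
  also have "\<dots> \<le> sqrt ((?d - 1) * (pauli_sum4 n \<phi> - 1))"
  proof (rule real_le_rsqrt)
    have "(\<Sum>v\<in>pvecs n - {pzero}. (cmod (pauli_coeff n \<rho> v))\<^sup>2 * (cmod (pauli_coeff n (proj n \<phi>) v))\<^sup>2)\<^sup>2
      \<le> (\<Sum>v\<in>pvecs n - {pzero}. ((cmod (pauli_coeff n \<rho> v))\<^sup>2)\<^sup>2) * (\<Sum>v\<in>pvecs n - {pzero}. ((cmod (pauli_coeff n (proj n \<phi>) v))\<^sup>2)\<^sup>2)"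
      by (rule Cauchy_Schwarz_ineq_sum)
    also have "\<dots> = (\<Sum>v\<in>pvecs n - {pzero}. (cmod (pauli_coeff n \<rho> v)) ^ 4) * (pauli_sum4 n \<phi> - 1)"
      by (simp add: pauli_sum4_minus_1[OF u])
    also have "\<dots> \<le> (?d - 1) * (pauli_sum4 n \<phi> - 1)"
      by (rule mult_right_mono[OF sum_pauli_coeff_density_pow4[OF R]]) (use pauli_sum4_ge_1[OF u] in simp)
    finally show "(\<Sum>v\<in>pvecs n - {pzero}. (cmod (pauli_coeff n \<rho> v))\<^sup>2 * (cmod (pauli_coeff n (proj n \<phi>) v))\<^sup>2)\<^sup>2 \<le> (?d - 1) * (pauli_sum4 n \<phi> - 1)" .
  qed
  finally have F_le: "F \<le> sqrt ((?d - 1) * (pauli_sum4 n \<phi> - 1))" .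
  have "G \<le> ?d * F" unfolding G_def F_def by (rule symp_sign_form_le)
  then have GF: "F + G / ?d \<le> 2 * F" using dpos by (simp add: field_simps)
  have R': "supp_mat (2 ^ n) \<rho>" "hermitian \<rho>" using R unfolding density_def hermitian_def by blast+
  have "Vshadow n (obs n \<phi>) \<rho> = (?d + 1) / (?d * (?d + 2)) * (F + G / ?d)
      - (Re (tr (2 ^ n) (mmul (2 ^ n) (obs n \<phi>) \<rho>)))\<^sup>2 / (?d + 2)"
    unfolding F_def G_def f_def by (rule Vshadow_eq[OF supp_obs hermitian_obs tr_obs[OF u] R'])
  then have "Vshadow n (obs n \<phi>) \<rho> \<le> (?d + 1) / (?d * (?d + 2)) * (F + G / ?d)"
    using dpos by simp
  also have "\<dots> \<le> (?d + 1) / (?d * (?d + 2)) * (2 * sqrt ((?d - 1) * (pauli_sum4 n \<phi> - 1)))"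
    by (rule mult_left_mono) (use GF F_le dpos in auto)
  finally show ?thesis by (simp only: times_divide_eq_left times_divide_eq_right mult_ac)
qed

theorem theorem4:
  fixes n :: nat and \<phi> :: cvec
  assumes "n \<ge> 1" and "unit_state n \<phi>"
  defines "d \<equiv> (2::nat) ^ n"
  defines "Ob \<equiv> madd d (proj n \<phi>) (msmult d (- (1 / of_nat d)) (idm d))"
  shows "Vshadow_max n Ob < 2 powr (1 - M2 n \<phi> / 2) * (real d + 1) / (real d + 2)
     \<and> Vshadow n Ob (proj n \<phi>) = (2 powr (1 - M2 n \<phi>) * (real d + 1) - 4) / (real d + 2)
     \<and> Vshadow n Ob (proj n \<phi>) < 2 powr (1 - M2 n \<phi>)"
proof -
  note u = assms(2)
  define D where "D = (2::real) ^ n"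
  define m where "m = 2 powr (- M2 n \<phi>)"
  have Ob: "Ob = obs n \<phi>" by (simp add: Ob_def obs_def d_def)
  have rd: "real d = D" by (simp add: d_def D_def)
  have D: "D > 0" "D + 1 > 0" "D + 2 > 0" by (simp_all add: D_def add_pos_pos)
  have m: "m > 0" "pauli_sum4 n \<phi> = D * m"
    unfolding m_def by simp (use powr_M2[OF u] in \<open>simp add: D_def\<close>)
  have p1: "2 powr (1 - M2 n \<phi>) = 2 * m"
    by (simp add: m_def powr_diff powr_minus divide_simps)
  have p2: "2 powr (1 - M2 n \<phi> / 2) = 2 * sqrt m"
  proof -
    have "sqrt m = 2 powr (- M2 n \<phi> / 2)"
      by (rule real_sqrt_unique) (simp_all add: m_def power2_eq_square powr_add[symmetric])
    then show ?thesis using powr_add[of 2 1 "- M2 n \<phi> / 2"] by simp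
  qed
  have pure: "Vshadow n Ob (proj n \<phi>) = (2 * m * (D + 1) - 4) / (D + 2)"
    using Vshadow_obs_pure[OF u] m D by (simp add: Ob D_def)
  have "2 * m * (D + 1) - 4 < 2 * m * (D + 2)" using m by (simp add: algebra_simps)
  then have lt: "(2 * m * (D + 1) - 4) / (D + 2) < 2 * m" using D by (simp add: pos_divide_less_eq)
  let ?B = "2 * (D + 1) / (D * (D + 2)) * sqrt ((D - 1) * (D * m - 1))"
  have "Vshadow_max n Ob \<le> ?B"
    unfolding Vshadow_max_def
  proof (rule cSup_least)
    show "{Vshadow n Ob \<rho> |\<rho>. density n \<rho>} \<noteq> {}" using density_proj[OF u] by blast
    fix x assume "x \<in> {Vshadow n Ob \<rho> |\<rho>. density n \<rho>}"
    then show "x \<le> ?B" using Vshadow_obs_le[OF u] by (auto simp: Ob D_def[symmetric] m(2))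
  qed
  also have "?B < 2 * (D + 1) / (D * (D + 2)) * (D * sqrt m)"
  proof (rule mult_strict_left_mono)
    have "(D - 1) * (D * m - 1) < D * D * m"
    proof -
      have "1 < D" using assms(1) by (simp add: D_def one_less_power)
      moreover have "0 < D * m" using D m by simp
      ultimately show ?thesis by (simp add: algebra_simps)
    qed
    then have "sqrt ((D - 1) * (D * m - 1)) < sqrt (D * D * m)" by (rule real_sqrt_less_mono)
    also have "\<dots> = D * sqrt m" using D by (simp add: real_sqrt_mult)
    finally show "sqrt ((D - 1) * (D * m - 1)) < D * sqrt m" .
  qed (use D in simp)
  also have "\<dots> = 2 * sqrt m * (D + 1) / (D + 2)"
  proof -
    have "D \<noteq> 0" "D + 2 \<noteq> 0" using D by auto
    then show ?thesis by (simp add: divide_simps)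
  qed
  finally show ?thesis unfolding p1 p2 rd pure using lt by simp
qed

end
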